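(* Let $M$ be an $F$-structure manifold of degree $K$, i.e. a smooth manifold with a nonzero $(1,1)$-tensor field $F$ of constant rank $r=2k$ satisfying $\alpha F^{K+1}+\beta F^{K}+F=0$, and let $\widehat{F}=(\alpha F^{K}+\beta F^{K-1})^{1/2}$. If $\widehat{F}$ is integrable (i.e. $N_{\widehat{F}}=0$), then the complex subbundle $$H=\{X-j\widehat{F}X : X\in D_l\}\subset T^{\mathbb{C}}M$$ is a CR-structure on $M$.
   Context: $K\ge 3$ is an integer and $\alpha,\beta$ are real or complex numbers (polynomials in $F$ with complex coefficients are regarded as endomorphisms of the complexified tangent bundle). Put $l=-(\alpha F^{K}+\beta F^{K-1})$, $m=I-l$; these are complementary projections, and $D_l=\mathrm{Im}\,l$, $D_m=\mathrm{Im}\,m$ are distributions on $M$ of dimensions $r$ and $n-r$, $n=\dim M$. $\widehat{F}=(\alpha F^{K}+\beta F^{K-1})^{1/2}$ denotes a (real, smooth) $(1,1)$-tensor field on $M$ with $\widehat{F}^2=\alpha F^{K}+\beta F^{K-1}=-l$ and $l\widehat{F}=\widehat{F}l=\widehat{F}$, $m\widehat{F}=\widehat{F}m=0$ (so $\widehat F$ acts as an almost complex structure on $D_l$ and as zero on $D_m$). For a $(1,1)$-tensor field $T$, the Nijenhuis tensor is $N_T(X,Y)=[TX,TY]-T[TX,Y]-T[X,TY]+T^2[X,Y]$, and $T$ is called integrable when $N_T=0$. $T^{\mathbb{C}}M=TM\otimes_{\mathbb{R}}\mathbb{C}$ is the complexified tangent bundle and $j$ the imaginary unit. A CR-structure on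 $M$ is a complex subbundle $H$ of $T^{\mathbb{C}}M$ with $H\cap\overline{H}=\{0\}$ and $H$ involutive (closed under the complex-bilinear extension of the Lie bracket). *)

theory Defs
  imports "HOL-Analysis.Analysis" "HOL-Library.Function_Algebras"
begin

section \<open>Pointwise real vector space structure on functions\<close>

instantiation "fun" :: (type, real_vector) real_vector
begin

definition scaleR_fun :: "real \<Rightarrow> ('a \<Rightarrow> 'b) \<Rightarrow> 'a \<Rightarrow> 'b" where
  "scaleR_fun a f = (\<lambda>x. a *\<^sub>R f x)"

instance
  by standard (auto simp: scaleR_fun_def fun_eq_iff algebra_simps)

end


section \<open>Smooth functions between normed spaces\<close>

text \<open>Intended for open \<open>S\<close> in a finite-dimensional space, where continuity of all iterated
  directional derivatives is the usual \<open>C\<^sup>n\<close> condition.\<close>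

primrec Ck_on :: "nat \<Rightarrow> 'a::real_normed_vector set \<Rightarrow> ('a \<Rightarrow> 'b::real_normed_vector) \<Rightarrow> bool" where
  "Ck_on 0 S f \<longleftrightarrow> continuous_on S f"
| "Ck_on (Suc n) S f \<longleftrightarrow>
     (\<forall>x\<in>S. f differentiable (at x)) \<and>
     (\<forall>v. Ck_on n S (\<lambda>x. frechet_derivative f (at x) v))"

definition smooth_on :: "'a::real_normed_vector set \<Rightarrow> ('a \<Rightarrow> 'b::real_normed_vector) \<Rightarrow> bool" where
  "smooth_on S f \<longleftrightarrow> (\<forall>n. Ck_on n S f)"


section \<open>Smooth manifolds\<close>

text \<open>A chart \<open>(U, \<phi>)\<close> is a coordinate domain with a coordinate map, whose values
  outside \<open>U\<close> are irrelevant. The dimension of the manifold is that of the model space.\<close>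

type_synonym ('m, 'e) chart = "'m set \<times> ('m \<Rightarrow> 'e)"

definition chart_inv :: "('m, 'e) chart \<Rightarrow> 'e \<Rightarrow> 'm" where
  "chart_inv c = inv_into (fst c) (snd c)"

definition transition :: "('m, 'e) chart \<Rightarrow> ('m, 'e) chart \<Rightarrow> 'e \<Rightarrow> 'e" where
  "transition c d = snd d \<circ> chart_inv c"

definition is_chart :: "'m topology \<Rightarrow> ('m, 'e::euclidean_space) chart \<Rightarrow> bool" where
  "is_chart M c \<longleftrightarrow>
     openin M (fst c) \<and> open (snd c ` fst c) \<and>
     homeomorphic_map (subtopology M (fst c)) (top_of_set (snd c ` fst c)) (snd c)"

text \<open>The atlas \<open>A\<close> need not be maximal.\<close>

definition smooth_manifold :: "'m topology \<Rightarrow> ('m, 'e::euclidean_space) chart set \<Rightarrow> bool" where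
  "smooth_manifold M A \<longleftrightarrow>
     Hausdorff_space M \<and> second_countable M \<and>
     (\<forall>c\<in>A. is_chart M c) \<and> (\<Union>c\<in>A. fst c) = topspace M \<and>
     (\<forall>c\<in>A. \<forall>d\<in>A. smooth_on (snd c ` (fst c \<inter> fst d)) (transition c d))"


section \<open>Tangent vectors and vector fields\<close>

text \<open>A tangent vector at \<open>p\<close> assigns to every chart around \<open>p\<close> its components in that chart,
  subject to the transformation law; it is set to \<open>0\<close> at all other charts, so that
  equality of tangent vectors is equality of functions.\<close>

type_synonym ('m, 'e) tvec = "('m, 'e) chart \<Rightarrow> 'e"

definition tangent_space ::
  "('m, 'e::euclidean_space) chart set \<Rightarrow> 'm \<Rightarrow> ('m, 'e) tvec set" where
  "tangent_space A p =
     {v. (\<forall>c. \<not> (c \<in> A \<and> p \<in> fst c) \<longrightarrow> v c = 0) \<and>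
         (\<forall>c\<in>A. \<forall>d\<in>A. p \<in> fst c \<inter> fst d \<longrightarrow>
            v d = frechet_derivative (transition c d) (at (snd c p)) (v c))}"

text \<open>The tangent vector at \<open>p\<close> with components \<open>v\<close> in the chart \<open>c\<close>.\<close>

definition coord_vec ::
  "('m, 'e::euclidean_space) chart set \<Rightarrow> ('m, 'e) chart \<Rightarrow> 'e \<Rightarrow> 'm \<Rightarrow> ('m, 'e) tvec" where
  "coord_vec A c v p = (\<lambda>d. if d \<in> A \<and> p \<in> fst d
     then frechet_derivative (transition c d) (at (snd c p)) v else 0)"

definition local_rep :: "('m \<Rightarrow> ('m, 'e) tvec) \<Rightarrow> ('m, 'e) chart \<Rightarrow> 'e \<Rightarrow> 'e" where
  "local_rep X c = (\<lambda>x. X (chart_inv c x) c)"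

definition vector_field ::
  "('m, 'e::euclidean_space) chart set \<Rightarrow> 'm set \<Rightarrow> ('m \<Rightarrow> ('m, 'e) tvec) \<Rightarrow> bool" where
  "vector_field A U X \<longleftrightarrow>
     (\<forall>p\<in>U. X p \<in> tangent_space A p) \<and>
     (\<forall>c\<in>A. smooth_on (snd c ` (fst c \<inter> U)) (local_rep X c))"

text \<open>In coordinates, \<open>[X, Y]\<^sup>k = X\<^sup>i \<partial>\<^sub>i Y\<^sup>k - Y\<^sup>i \<partial>\<^sub>i X\<^sup>k\<close>.\<close>

definition lie_bracket ::
  "('m, 'e::euclidean_space) chart set \<Rightarrow> ('m \<Rightarrow> ('m, 'e) tvec) \<Rightarrow> ('m \<Rightarrow> ('m, 'e) tvec)
     \<Rightarrow> 'm \<Rightarrow> ('m, 'e) tvec" where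
  "lie_bracket A X Y p = (\<lambda>c. if c \<in> A \<and> p \<in> fst c
     then frechet_derivative (local_rep Y c) (at (snd c p)) (X p c)
        - frechet_derivative (local_rep X c) (at (snd c p)) (Y p c)
     else 0)"


section \<open>(1,1)-tensor fields and the Nijenhuis tensor\<close>

type_synonym ('m, 'e) tensor11 = "'m \<Rightarrow> ('m, 'e) tvec \<Rightarrow> ('m, 'e) tvec"

text \<open>The last conjunct says that the components of \<open>T\<close> in every chart are smooth.\<close>

definition tensor_field11 ::
  "'m topology \<Rightarrow> ('m, 'e::euclidean_space) chart set \<Rightarrow> ('m, 'e) tensor11 \<Rightarrow> bool" where
  "tensor_field11 M A T \<longleftrightarrow>
     (\<forall>p\<in>topspace M.
        (\<forall>u\<in>tangent_space A p. T p u \<in> tangent_space A p) \<and>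
        (\<forall>u\<in>tangent_space A p. \<forall>v\<in>tangent_space A p. T p (u + v) = T p u + T p v) \<and>
        (\<forall>a. \<forall>u\<in>tangent_space A p. T p (a *\<^sub>R u) = a *\<^sub>R T p u)) \<and>
     (\<forall>c\<in>A. \<forall>v. smooth_on (snd c ` fst c) (local_rep (\<lambda>p. T p (coord_vec A c v p)) c))"

definition nijenhuis ::
  "('m, 'e::euclidean_space) chart set \<Rightarrow> ('m, 'e) tensor11 \<Rightarrow>
     ('m \<Rightarrow> ('m, 'e) tvec) \<Rightarrow> ('m \<Rightarrow> ('m, 'e) tvec) \<Rightarrow> 'm \<Rightarrow> ('m, 'e) tvec" where
  "nijenhuis A T X Y p =
     lie_bracket A (\<lambda>q. T q (X q)) (\<lambda>q. T q (Y q)) p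
     - T p (lie_bracket A (\<lambda>q. T q (X q)) Y p)
     - T p (lie_bracket A X (\<lambda>q. T q (Y q)) p)
     + T p (T p (lie_bracket A X Y p))"

definition integrable_tensor ::
  "'m topology \<Rightarrow> ('m, 'e::euclidean_space) chart set \<Rightarrow> ('m, 'e) tensor11 \<Rightarrow> bool" where
  "integrable_tensor M A T \<longleftrightarrow>
     (\<forall>X Y. vector_field A (topspace M) X \<and> vector_field A (topspace M) Y \<longrightarrow>
        (\<forall>p\<in>topspace M. nijenhuis A T X Y p = 0))"


section \<open>The complexified tangent bundle\<close>

text \<open>The pair \<open>(u, v)\<close> represents \<open>u + j v\<close>.\<close>

type_synonym ('m, 'e) ctvec = "('m, 'e) tvec \<times> ('m, 'e) tvec"

definition cscale :: "complex \<Rightarrow> 'v::real_vector \<times> 'v \<Rightarrow> 'v \<times> 'v" where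
  "cscale a z = (Re a *\<^sub>R fst z - Im a *\<^sub>R snd z, Re a *\<^sub>R snd z + Im a *\<^sub>R fst z)"

lemma vector_space_cscale: "vector_space cscale"
  by standard (auto simp: cscale_def algebra_simps)

interpretation cplx: vector_space cscale
  by (rule vector_space_cscale)

definition of_tvec :: "'v::real_vector \<Rightarrow> 'v \<times> 'v" where
  "of_tvec u = (u, 0)"

definition conj_vec :: "'v::real_vector \<times> 'v \<Rightarrow> 'v \<times> 'v" where
  "conj_vec z = (fst z, - snd z)"

definition ctangent_space ::
  "('m, 'e::euclidean_space) chart set \<Rightarrow> 'm \<Rightarrow> ('m, 'e) ctvec set" where
  "ctangent_space A p = tangent_space A p \<times> tangent_space A p"

definition complexify :: "('m, 'e) tensor11 \<Rightarrow> 'm \<Rightarrow> ('m, 'e) ctvec \<Rightarrow> ('m, 'e) ctvec" where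
  "complexify T p = map_prod (T p) (T p)"

definition cvector_field ::
  "('m, 'e::euclidean_space) chart set \<Rightarrow> 'm set \<Rightarrow> ('m \<Rightarrow> ('m, 'e) ctvec) \<Rightarrow> bool" where
  "cvector_field A U Z \<longleftrightarrow> vector_field A U (fst \<circ> Z) \<and> vector_field A U (snd \<circ> Z)"

definition clie_bracket ::
  "('m, 'e::euclidean_space) chart set \<Rightarrow> ('m \<Rightarrow> ('m, 'e) ctvec) \<Rightarrow> ('m \<Rightarrow> ('m, 'e) ctvec)
     \<Rightarrow> 'm \<Rightarrow> ('m, 'e) ctvec" where
  "clie_bracket A Z W p =
     (lie_bracket A (fst \<circ> Z) (fst \<circ> W) p - lie_bracket A (snd \<circ> Z) (snd \<circ> W) p,
      lie_bracket A (fst \<circ> Z) (snd \<circ> W) p + lie_bracket A (snd \<circ> Z) (fst \<circ> W) p)"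


section \<open>CR-structures\<close>

definition complex_subbundle ::
  "'m topology \<Rightarrow> ('m, 'e::euclidean_space) chart set \<Rightarrow> ('m \<Rightarrow> ('m, 'e) ctvec set) \<Rightarrow> bool" where
  "complex_subbundle M A H \<longleftrightarrow>
     (\<forall>p\<in>topspace M. cplx.subspace (H p) \<and> H p \<subseteq> ctangent_space A p) \<and>
     (\<exists>d::nat. \<forall>p\<in>topspace M. \<exists>U Z. openin M U \<and> p \<in> U \<and>
        (\<forall>i<d. cvector_field A U (Z i)) \<and>
        (\<forall>q\<in>U. inj_on (\<lambda>i. Z i q) {..<d} \<and>
               cplx.independent ((\<lambda>i. Z i q) ` {..<d}) \<and>
               cplx.span ((\<lambda>i. Z i q) ` {..<d}) = H q))"

text \<open>Sections are taken over arbitrary open sets, including the whole manifold.\<close>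

definition involutive ::
  "'m topology \<Rightarrow> ('m, 'e::euclidean_space) chart set \<Rightarrow> ('m \<Rightarrow> ('m, 'e) ctvec set) \<Rightarrow> bool" where
  "involutive M A H \<longleftrightarrow>
     (\<forall>U Z W. openin M U \<and> cvector_field A U Z \<and> cvector_field A U W \<and>
        (\<forall>p\<in>U. Z p \<in> H p \<and> W p \<in> H p) \<longrightarrow>
        (\<forall>p\<in>U. clie_bracket A Z W p \<in> H p))"

definition CR_structure ::
  "'m topology \<Rightarrow> ('m, 'e::euclidean_space) chart set \<Rightarrow> ('m \<Rightarrow> ('m, 'e) ctvec set) \<Rightarrow> bool" where
  "CR_structure M A H \<longleftrightarrow>
     complex_subbundle M A H \<and>
     (\<forall>p\<in>topspace M. H p \<inter> conj_vec ` H p = {0}) \<and>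
     involutive M A H"


section \<open>F-structures of degree K\<close>

definition F_structure ::
  "'m topology \<Rightarrow> ('m, 'e::euclidean_space) chart set \<Rightarrow> complex \<Rightarrow> complex \<Rightarrow> nat \<Rightarrow> nat
     \<Rightarrow> ('m, 'e) tensor11 \<Rightarrow> bool" where
  "F_structure M A \<alpha> \<beta> K r F \<longleftrightarrow>
     tensor_field11 M A F \<and>
     (\<exists>p\<in>topspace M. \<exists>u\<in>tangent_space A p. F p u \<noteq> 0) \<and>
     (\<forall>p\<in>topspace M. dim (F p ` tangent_space A p) = r) \<and>
     (\<forall>p\<in>topspace M. \<forall>z\<in>ctangent_space A p.
        cscale \<alpha> ((complexify F p ^^ (K + 1)) z) + cscale \<beta> ((complexify F p ^^ K) z)
        + complexify F p z = 0)"

definition proj_l ::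
  "complex \<Rightarrow> complex \<Rightarrow> nat \<Rightarrow> ('m, 'e::euclidean_space) tensor11
     \<Rightarrow> 'm \<Rightarrow> ('m, 'e) ctvec \<Rightarrow> ('m, 'e) ctvec" where
  "proj_l \<alpha> \<beta> K F p z =
     - (cscale \<alpha> ((complexify F p ^^ K) z) + cscale \<beta> ((complexify F p ^^ (K - 1)) z))"

definition proj_m ::
  "complex \<Rightarrow> complex \<Rightarrow> nat \<Rightarrow> ('m, 'e::euclidean_space) tensor11
     \<Rightarrow> 'm \<Rightarrow> ('m, 'e) ctvec \<Rightarrow> ('m, 'e) ctvec" where
  "proj_m \<alpha> \<beta> K F p z = z - proj_l \<alpha> \<beta> K F p z"

text \<open>The image of \<open>l\<close> as an operator on the real tangent bundle. This is meaningful for complex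
  \<open>\<alpha>\<close>, \<open>\<beta>\<close> because \<open>l\<close> is real as soon as \<open>- l\<close> is the square of a real tensor field.\<close>

definition D_l ::
  "('m, 'e::euclidean_space) chart set \<Rightarrow> complex \<Rightarrow> complex \<Rightarrow> nat \<Rightarrow> ('m, 'e) tensor11
     \<Rightarrow> 'm \<Rightarrow> ('m, 'e) tvec set" where
  "D_l A \<alpha> \<beta> K F p =
     {X \<in> tangent_space A p. \<exists>Y\<in>tangent_space A p. of_tvec X = proj_l \<alpha> \<beta> K F p (of_tvec Y)}"

text \<open>\<open>G\<close> is a real smooth square root \<open>(\<alpha> F\<^sup>K + \<beta> F\<^sup>K\<^sup>-\<^sup>1)\<^sup>1\<^sup>/\<^sup>2\<close>.\<close>

definition is_F_hat ::
  "'m topology \<Rightarrow> ('m, 'e::euclidean_space) chart set \<Rightarrow> complex \<Rightarrow> complex \<Rightarrow> nat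
     \<Rightarrow> ('m, 'e) tensor11 \<Rightarrow> ('m, 'e) tensor11 \<Rightarrow> bool" where
  "is_F_hat M A \<alpha> \<beta> K F G \<longleftrightarrow>
     tensor_field11 M A G \<and>
     (\<forall>p\<in>topspace M. \<forall>z\<in>ctangent_space A p.
        complexify G p (complexify G p z) =
          cscale \<alpha> ((complexify F p ^^ K) z) + cscale \<beta> ((complexify F p ^^ (K - 1)) z) \<and>
        proj_l \<alpha> \<beta> K F p (complexify G p z) = complexify G p z \<and>
        complexify G p (proj_l \<alpha> \<beta> K F p z) = complexify G p z \<and>
        proj_m \<alpha> \<beta> K F p (complexify G p z) = 0 \<and>
        complexify G p (proj_m \<alpha> \<beta> K F p z) = 0)"

definition H_bundle ::
  "('m, 'e::euclidean_space) chart set \<Rightarrow> complex \<Rightarrow> complex \<Rightarrow> nat \<Rightarrow> ('m, 'e) tensor11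
     \<Rightarrow> ('m, 'e) tensor11 \<Rightarrow> 'm \<Rightarrow> ('m, 'e) ctvec set" where
  "H_bundle A \<alpha> \<beta> K F G p =
     {of_tvec X - cscale \<i> (of_tvec (G p X)) | X. X \<in> D_l A \<alpha> \<beta> K F p}"

end

theory Submission
  imports Defs
begin

text \<open>Since \<open>F l = F\<close> and \<open>l = - Fhat\<^sup>2\<close>, the tensor field \<open>T = Fhat\<close> satisfies \<open>T\<^sup>3 = - T\<close> and its image is
  \<open>D\<^sub>l\<close>, which is also the image of \<open>F\<close> and hence has constant rank. For sections \<open>X, Y\<close> of \<open>D\<^sub>l\<close> one
  has \<open>T\<^sup>2 X = - X\<close>, and the vanishing of \<open>N\<^sub>T\<close> on the pairs formed from \<open>X, Y, TX, TY\<close> shows that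
  \<open>V = [X, Y] - [TX, TY]\<close> lies in the image of \<open>T\<close> and that \<open>T V = [TX, Y] + [X, TY]\<close>. Thus the bracket
  of \<open>X - j TX\<close> and \<open>Y - j TY\<close> is \<open>V - j T V\<close>. Integrability is a hypothesis on globally defined vector
  fields, so local sections are first cut off by bump functions.\<close>

section \<open>Calculus of smooth functions\<close>

text \<open>\<open>H\<close> is prescribed point by point, so apart from involutivity the work lies
  in producing smooth local frames. Its fibre is the graph of \<open>- T\<close> over the image of
  \<open>T\<close>: real dimension r, hence complex rank r/2. A complex basis of one fibre is
  carried to nearby fibres by operators that are polynomial in the values of \<open>T\<close> at
  both points, hence smooth; constant rank guarantees that the carried vectors still span.
  Involutivity needs no frame: it is a computation with four brackets at a single point, resting on
  two foundations. A tangent vector is a compatible family of chart components, so a bracket is a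
  tangent vector only because second derivatives of transition maps are symmetric. And the bump
  functions that extend local sections must equal 1 near the point, since brackets see a
  neighbourhood.\<close>

lemma Ck_on_subset: "Ck_on n S f \<Longrightarrow> T \<subseteq> S \<Longrightarrow> Ck_on n T f"
  by (induction n arbitrary: f) (auto intro: continuous_on_subset)

text \<open>A Frechet derivative depends on a whole neighbourhood of the point, so agreement on
  \<open>S\<close> passes to derivatives only because \<open>S\<close> is open.\<close>

lemma Ck_on_cong:
  assumes "open S" and "\<And>x. x \<in> S \<Longrightarrow> f x = g x" and "Ck_on n S f"
  shows "Ck_on n S g"
  using assms(2,3)
proof (induction n arbitrary: f g)
  case 0
  then show ?case by (simp cong: continuous_on_cong)
next
  case (Suc n)
  have D: "(g has_derivative frechet_derivative f (at x)) (at x)" if "x \<in> S" for x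
  proof (rule has_derivative_transform_within_open)
    show "(f has_derivative frechet_derivative f (at x)) (at x)"
      using Suc.prems(2) that by (simp flip: frechet_derivative_works)
  qed (use that Suc.prems(1) assms(1) in auto)
  have "Ck_on n S (\<lambda>x. frechet_derivative g (at x) v)" for v
  proof (rule Suc.IH)
    show "Ck_on n S (\<lambda>x. frechet_derivative f (at x) v)"
      using Suc.prems by simp
    show "frechet_derivative f (at x) v = frechet_derivative g (at x) v" if "x \<in> S" for x
      using frechet_derivative_at[OF D[OF that]] by simp
  qed
  then show ?case using D by (auto simp: differentiable_def)
qed

text \<open>Lets the inductions below work with an explicit derivative instead of
  \<open>frechet_derivative\<close>.\<close>

lemma Ck_on_SucI:
  assumes "open S"
    and f': "\<And>x. x \<in> S \<Longrightarrow> (f has_derivative f' x) (at x)"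
    and "\<And>v. Ck_on n S (\<lambda>x. f' x v)"
  shows "Ck_on (Suc n) S f"
proof -
  have "f' x v = frechet_derivative f (at x) v" if "x \<in> S" for x v
    using frechet_derivative_at[OF f'[OF that]] by simp
  then show ?thesis
    using f' Ck_on_cong[OF assms(1) _ assms(3)] by (auto simp: differentiable_def)
qed

lemma Ck_on_has_derivative:
  "Ck_on (Suc n) S f \<Longrightarrow> x \<in> S \<Longrightarrow> (f has_derivative frechet_derivative f (at x)) (at x)"
  by (simp flip: frechet_derivative_works)

lemma Ck_on_SucD: "Ck_on (Suc n) S f \<Longrightarrow> Ck_on n S f"
proof (induction n arbitrary: f)
  case 0
  then show ?case
    by (auto intro!: continuous_at_imp_continuous_on differentiable_imp_continuous_within)
next
  case (Suc n)
  then show ?case unfolding Ck_on.simps(2)[of "Suc n"] Ck_on.simps(2)[of n] by blast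
qed

text \<open>Derivatives are taken in the full space, not within \<open>S\<close>, so smoothness may
  be checked on an open cover. This is the gluing behind cut-off fields.\<close>

lemma Ck_on_UN:
  assumes "\<And>i. i \<in> I \<Longrightarrow> open (S i)" and "\<And>i. i \<in> I \<Longrightarrow> Ck_on n (S i) f"
  shows "Ck_on n (\<Union>i\<in>I. S i) f"
  using assms(2)
  by (induction n arbitrary: f) (auto intro: continuous_on_open_UN assms(1))

lemma Ck_on_const: "open S \<Longrightarrow> Ck_on n S (\<lambda>x. c)"
  by (induction n arbitrary: c) auto

lemma Ck_on_bounded_linear:
  assumes "bounded_linear h" and "open S" and "Ck_on n S f"
  shows "Ck_on n S (\<lambda>x. h (f x))"
  using assms(3)
proof (induction n arbitrary: f)
  case 0
  then show ?case
    using assms(1) by (auto intro: bounded_linear.continuous_on)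
next
  case (Suc n)
  show ?case
  proof (rule Ck_on_SucI[OF assms(2)])
    show "((\<lambda>x. h (f x)) has_derivative (\<lambda>v. h (frechet_derivative f (at x) v))) (at x)"
      if "x \<in> S" for x
      using Ck_on_has_derivative[OF Suc.prems that] assms(1)
      by (rule bounded_linear.has_derivative[rotated])
  qed (use Suc in auto)
qed

lemma Ck_on_add:
  assumes "open S" and "Ck_on n S f" and "Ck_on n S g"
  shows "Ck_on n S (\<lambda>x. f x + g x)"
  using assms(2,3)
proof (induction n arbitrary: f g)
  case 0
  then show ?case by (auto intro: continuous_intros)
next
  case (Suc n)
  show ?case
  proof (rule Ck_on_SucI[OF assms(1)])
    show "((\<lambda>x. f x + g x) has_derivative
        (\<lambda>v. frechet_derivative f (at x) v + frechet_derivative g (at x) v)) (at x)"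
      if "x \<in> S" for x
      using Suc.prems that by (intro has_derivative_add Ck_on_has_derivative)
  qed (use Suc in auto)
qed

text \<open>The product rule leaves one factor undifferentiated, so C^(n+1) has to be lowered to C^n
  before the induction hypothesis applies.\<close>

lemma Ck_on_scaleR:
  assumes "open S" and "Ck_on n S f" and "Ck_on n S g"
  shows "Ck_on n S (\<lambda>x. f x *\<^sub>R g x)"
  using assms(2,3)
proof (induction n arbitrary: f g)
  case 0
  then show ?case by (auto intro: continuous_intros)
next
  case (Suc n)
  show ?case
  proof (rule Ck_on_SucI[OF assms(1)])
    show "((\<lambda>x. f x *\<^sub>R g x) has_derivative
        (\<lambda>v. f x *\<^sub>R frechet_derivative g (at x) v + frechet_derivative f (at x) v *\<^sub>R g x)) (at x)"
      if "x \<in> S" for x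
      using Suc.prems that by (intro has_derivative_scaleR Ck_on_has_derivative)
    show "Ck_on n S (\<lambda>x. f x *\<^sub>R frechet_derivative g (at x) v + frechet_derivative f (at x) v *\<^sub>R g x)"
      for v
    proof (intro Ck_on_add[OF assms(1)] Suc.IH)
      show "Ck_on n S f" "Ck_on n S g" using Suc.prems by (auto intro: Ck_on_SucD)
    qed (use Suc.prems in auto)
  qed
qed

lemma Ck_on_sum:
  assumes "open S" and "\<And>i. i \<in> I \<Longrightarrow> Ck_on n S (f i)"
  shows "Ck_on n S (\<lambda>x. \<Sum>i\<in>I. f i x)"
  using assms(2)
  by (induction I rule: infinite_finite_induct) (auto intro: Ck_on_const Ck_on_add assms(1))

lemma linear_eq_sum_Basis:
  fixes L :: "'a::euclidean_space \<Rightarrow> 'b::real_vector"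
  assumes "linear L"
  shows "L w = (\<Sum>b\<in>Basis. (w \<bullet> b) *\<^sub>R L b)"
proof -
  have "L w = L (\<Sum>b\<in>Basis. (w \<bullet> b) *\<^sub>R b)"
    by (simp add: euclidean_representation)
  then show ?thesis
    by (simp add: linear_sum[OF assms] linear_cmul[OF assms])
qed

text \<open>In a basis the expression becomes a finite sum of scalar multiples. It is the tool for
  the chain rule and for changing components between charts.\<close>

lemma Ck_on_linear_apply:
  fixes L :: "'a::real_normed_vector \<Rightarrow> 'b::euclidean_space \<Rightarrow> 'c::real_normed_vector"
  assumes "open S" and L: "\<And>x. x \<in> S \<Longrightarrow> linear (L x)"
    and "\<And>b. Ck_on n S (\<lambda>x. L x b)" and "Ck_on n S w"
  shows "Ck_on n S (\<lambda>x. L x (w x))"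
proof (rule Ck_on_cong[OF assms(1)])
  show "Ck_on n S (\<lambda>x. \<Sum>b\<in>Basis. (w x \<bullet> b) *\<^sub>R L x b)"
    using assms
    by (intro Ck_on_sum Ck_on_scaleR Ck_on_bounded_linear[OF bounded_linear_inner_left])
qed (simp add: linear_eq_sum_Basis[OF L, symmetric])

text \<open>The chain rule gives an operator depending on \<open>x\<close> applied to a vector
  depending on \<open>x\<close>. The induction varies \<open>g\<close> because its hypothesis is
  used for directional derivatives of \<open>g\<close>, composed with the same
  \<open>f\<close>.\<close>

lemma Ck_on_compose:
  fixes g :: "'b::euclidean_space \<Rightarrow> 'c::real_normed_vector"
  assumes "open S" and "open T" and "f ` S \<subseteq> T"
    and "Ck_on n S f" and "Ck_on n T g"
  shows "Ck_on n S (\<lambda>x. g (f x))"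
  using assms(4,5)
proof (induction n arbitrary: g)
  case 0
  then show ?case
    using continuous_on_compose2[of T g S f] assms(3) by simp
next
  case (Suc n)
  note f' = Ck_on_has_derivative[OF Suc.prems(1)] and g' = Ck_on_has_derivative[OF Suc.prems(2)]
  have f: "Ck_on n S f" using Suc.prems(1) by (rule Ck_on_SucD)
  show ?case
  proof (rule Ck_on_SucI[OF assms(1)])
    show "((\<lambda>x. g (f x)) has_derivative
        (\<lambda>v. frechet_derivative g (at (f x)) (frechet_derivative f (at x) v))) (at x)"
      if "x \<in> S" for x
      using has_derivative_compose[OF f'[OF that] g'] that assms(3) by auto
    show "Ck_on n S (\<lambda>x. frechet_derivative g (at (f x)) (frechet_derivative f (at x) v))" for v
    proof (rule Ck_on_linear_apply[OF assms(1)])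
      show "linear (frechet_derivative g (at (f x)))" if "x \<in> S" for x
        using g' that assms(3) has_derivative_linear by blast
      show "Ck_on n S (\<lambda>x. frechet_derivative g (at (f x)) b)" for b
        using Suc.prems(2) by (intro Suc.IH[of "\<lambda>z. frechet_derivative g (at z) b", OF f]) simp
    qed (use Suc.prems(1) in simp)
  qed
qed

section \<open>The same rules for smooth functions\<close>

lemma smooth_on_subset: "smooth_on S f \<Longrightarrow> T \<subseteq> S \<Longrightarrow> smooth_on T f"
  by (auto simp: smooth_on_def intro: Ck_on_subset)

lemma smooth_on_cong:
  "open S \<Longrightarrow> (\<And>x. x \<in> S \<Longrightarrow> f x = g x) \<Longrightarrow> smooth_on S f \<Longrightarrow> smooth_on S g"
  by (auto simp: smooth_on_def intro: Ck_on_cong)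

lemma smooth_on_Un:
  "open S \<Longrightarrow> open T \<Longrightarrow> smooth_on S f \<Longrightarrow> smooth_on T f \<Longrightarrow> smooth_on (S \<union> T) f"
  using Ck_on_UN[of "{S, T}" "\<lambda>S. S"] by (auto simp: smooth_on_def)

lemma smooth_on_const: "open S \<Longrightarrow> smooth_on S (\<lambda>x. c)"
  by (auto simp: smooth_on_def intro: Ck_on_const)

lemma smooth_on_bounded_linear:
  "bounded_linear h \<Longrightarrow> open S \<Longrightarrow> smooth_on S f \<Longrightarrow> smooth_on S (\<lambda>x. h (f x))"
  by (auto simp: smooth_on_def intro: Ck_on_bounded_linear)

lemma smooth_on_add:
  "open S \<Longrightarrow> smooth_on S f \<Longrightarrow> smooth_on S g \<Longrightarrow> smooth_on S (\<lambda>x. f x + g x)"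
  by (auto simp: smooth_on_def intro: Ck_on_add)

lemma smooth_on_scaleR:
  "open S \<Longrightarrow> smooth_on S f \<Longrightarrow> smooth_on S g \<Longrightarrow> smooth_on S (\<lambda>x. f x *\<^sub>R g x)"
  by (auto simp: smooth_on_def intro: Ck_on_scaleR)

lemma smooth_on_sum:
  "open S \<Longrightarrow> (\<And>i. i \<in> I \<Longrightarrow> smooth_on S (f i)) \<Longrightarrow> smooth_on S (\<lambda>x. \<Sum>i\<in>I. f i x)"
  by (auto simp: smooth_on_def intro: Ck_on_sum)

lemma smooth_on_linear_apply:
  fixes L :: "'a::real_normed_vector \<Rightarrow> 'b::euclidean_space \<Rightarrow> 'c::real_normed_vector"
  shows "open S \<Longrightarrow> (\<And>x. x \<in> S \<Longrightarrow> linear (L x)) \<Longrightarrow> (\<And>b. smooth_on S (\<lambda>x. L x b)) \<Longrightarrow>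
    smooth_on S w \<Longrightarrow> smooth_on S (\<lambda>x. L x (w x))"
  by (auto simp: smooth_on_def intro: Ck_on_linear_apply)

lemma smooth_on_compose:
  fixes g :: "'b::euclidean_space \<Rightarrow> 'c::real_normed_vector"
  shows "open S \<Longrightarrow> open T \<Longrightarrow> f ` S \<subseteq> T \<Longrightarrow> smooth_on S f \<Longrightarrow> smooth_on T g \<Longrightarrow>
    smooth_on S (\<lambda>x. g (f x))"
  by (auto simp: smooth_on_def intro: Ck_on_compose)

lemma smooth_on_frechet: "smooth_on S f \<Longrightarrow> smooth_on S (\<lambda>x. frechet_derivative f (at x) v)"
  unfolding smooth_on_def using Ck_on.simps(2) by blast

lemma smooth_on_has_derivative:
  "smooth_on S f \<Longrightarrow> x \<in> S \<Longrightarrow> (f has_derivative frechet_derivative f (at x)) (at x)"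
  unfolding smooth_on_def by (meson Ck_on_has_derivative)

lemma smooth_on_differentiable: "smooth_on S f \<Longrightarrow> x \<in> S \<Longrightarrow> f differentiable (at x)"
  unfolding smooth_on_def by (meson Ck_on.simps(2))

lemma smooth_on_imp_continuous_on: "smooth_on S f \<Longrightarrow> continuous_on S f"
  unfolding smooth_on_def by (metis Ck_on.simps(1))

lemma smooth_on_ident: "open S \<Longrightarrow> smooth_on S (\<lambda>x. x)"
  unfolding smooth_on_def
proof
  show "Ck_on n S (\<lambda>x. x)" if "open S" for n
    using that by (cases n) (auto intro: Ck_on_const)
qed


section \<open>Symmetry of second derivatives\<close>

text \<open>The mean value theorem is applied twice: in direction \<open>u\<close> to the increment
  \<open>g\<close> taken along \<open>v\<close>, then in direction \<open>v\<close> to the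
  derivative along \<open>u\<close>.\<close>

lemma second_difference_mvt:
  fixes f :: "'a::real_normed_vector \<Rightarrow> real"
  assumes "smooth_on (ball x r) f" and "0 < h" and h: "h * (norm u + norm v) < r"
  obtains s t where "s \<in> {0<..<h}" and "t \<in> {0<..<h}"
    and "f (x + h *\<^sub>R u + h *\<^sub>R v) - f (x + h *\<^sub>R u) - f (x + h *\<^sub>R v) + f x =
      h * h * frechet_derivative (\<lambda>z. frechet_derivative f (at z) u) (at (x + s *\<^sub>R u + t *\<^sub>R v)) v"
proof -
  let ?Df = "\<lambda>z. frechet_derivative f (at z)"
  have in_ball: "x + s *\<^sub>R u + t *\<^sub>R v \<in> ball x r" if "s \<in> {0..h}" "t \<in> {0..h}" for s t
  proof -
    have "norm (s *\<^sub>R u + t *\<^sub>R v) \<le> s * norm u + t * norm v"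
      using that norm_triangle_ineq[of "s *\<^sub>R u" "t *\<^sub>R v"] by simp
    also have "\<dots> \<le> h * norm u + h * norm v"
      using that by (intro add_mono mult_right_mono) auto
    finally show ?thesis
      using h by (simp add: dist_commute[of x] dist_norm[of _ x] algebra_simps)
  qed
  have f': "(f has_derivative ?Df z) (at z)" if "z \<in> ball x r" for z
    using assms(1) that by (rule smooth_on_has_derivative)
  have d1: "((\<lambda>s. f (x + s *\<^sub>R u + t *\<^sub>R v)) has_real_derivative ?Df (x + s *\<^sub>R u + t *\<^sub>R v) u) (at s)"
    if "s \<in> {0..h}" "t \<in> {0..h}" for s t
  proof -
    have "((\<lambda>s. x + s *\<^sub>R u + t *\<^sub>R v) has_derivative (\<lambda>a. a *\<^sub>R u)) (at s)"
      by (auto intro!: derivative_eq_intros)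
    from has_derivative_compose[OF this f'[OF in_ball[OF that]]] show ?thesis
      using linear_cmul[OF has_derivative_linear[OF f'[OF in_ball[OF that]]]]
      by (simp add: has_field_derivative_def mult.commute[of _ "?Df _ _"] )
  qed
  define g where "g = (\<lambda>s. f (x + s *\<^sub>R u + h *\<^sub>R v) - f (x + s *\<^sub>R u))"
  have dg: "(g has_real_derivative ?Df (x + s *\<^sub>R u + h *\<^sub>R v) u - ?Df (x + s *\<^sub>R u + 0 *\<^sub>R v) u) (at s)"
    if "s \<in> {0..h}" for s
    unfolding g_def using d1[of s h] d1[of s 0] that assms(2) by (auto intro: DERIV_diff)
  obtain s where s: "0 < s" "s < h"
    and gs: "g h - g 0 = (h - 0) * (?Df (x + s *\<^sub>R u + h *\<^sub>R v) u - ?Df (x + s *\<^sub>R u + 0 *\<^sub>R v) u)"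
    using MVT2[of 0 h g, OF assms(2) dg] by auto
  let ?Dfu = "\<lambda>z. ?Df z u"
  let ?D2 = "\<lambda>z. frechet_derivative ?Dfu (at z)"
  have smu: "smooth_on (ball x r) ?Dfu"
    using assms(1) by (rule smooth_on_frechet)
  have d2: "((\<lambda>t. ?Dfu (x + s *\<^sub>R u + t *\<^sub>R v)) has_real_derivative ?D2 (x + s *\<^sub>R u + t *\<^sub>R v) v) (at t)"
    if "t \<in> {0..h}" for t
  proof -
    have D2: "(?Dfu has_derivative ?D2 (x + s *\<^sub>R u + t *\<^sub>R v)) (at (x + s *\<^sub>R u + t *\<^sub>R v))"
      using smu in_ball[of s t] that s by (intro smooth_on_has_derivative) auto
    have "((\<lambda>t. x + s *\<^sub>R u + t *\<^sub>R v) has_derivative (\<lambda>a. a *\<^sub>R v)) (at t)"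
      by (auto intro!: derivative_eq_intros)
    from has_derivative_compose[OF this D2] show ?thesis
      using linear_cmul[OF has_derivative_linear[OF D2]]
      by (simp add: has_field_derivative_def mult.commute[of _ "?D2 _ _"])
  qed
  obtain t where t: "0 < t" "t < h"
    and ht: "?Dfu (x + s *\<^sub>R u + h *\<^sub>R v) - ?Dfu (x + s *\<^sub>R u + 0 *\<^sub>R v) =
      (h - 0) * ?D2 (x + s *\<^sub>R u + t *\<^sub>R v) v"
    using MVT2[of 0 h "\<lambda>t. ?Dfu (x + s *\<^sub>R u + t *\<^sub>R v)", OF assms(2) d2] by auto
  show thesis
  proof (rule that)
    show "s \<in> {0<..<h}" "t \<in> {0<..<h}" using s t by auto
    show "f (x + h *\<^sub>R u + h *\<^sub>R v) - f (x + h *\<^sub>R u) - f (x + h *\<^sub>R v) + f x =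
        h * h * ?D2 (x + s *\<^sub>R u + t *\<^sub>R v) v"
      using gs ht by (simp add: g_def)
  qed
qed

text \<open>The second difference does not change when \<open>u\<close> and \<open>v\<close> are
  exchanged, so a value of one mixed derivative near \<open>x\<close> equals a value of the other
  near \<open>x\<close>; continuity then identifies them at \<open>x\<close>.\<close>

lemma symmetric_second_derivative_real:
  fixes f :: "'a::real_normed_vector \<Rightarrow> real"
  assumes "open S" and "smooth_on S f" and "x \<in> S"
  shows "frechet_derivative (\<lambda>z. frechet_derivative f (at z) u) (at x) v =
    frechet_derivative (\<lambda>z. frechet_derivative f (at z) v) (at x) u" (is "?P x = ?Q x")
proof -
  obtain r where r: "0 < r" "ball x r \<subseteq> S"
    using assms(1,3) open_contains_ball by blast
  have sm: "smooth_on (ball x r) f"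
    using assms(2) r(2) by (rule smooth_on_subset)
  have cP: "continuous_on (ball x r) ?P" and cQ: "continuous_on (ball x r) ?Q"
    using sm by (auto intro!: smooth_on_imp_continuous_on smooth_on_frechet)
  have "dist (?P x) (?Q x) < e" if "0 < e" for e
  proof -
    obtain d1 where d1: "0 < d1" "\<And>y. y \<in> ball x r \<Longrightarrow> dist y x < d1 \<Longrightarrow> dist (?P y) (?P x) < e / 2"
      using cP r(1) \<open>0 < e\<close> unfolding continuous_on_iff by (metis centre_in_ball half_gt_zero)
    obtain d2 where d2: "0 < d2" "\<And>y. y \<in> ball x r \<Longrightarrow> dist y x < d2 \<Longrightarrow> dist (?Q y) (?Q x) < e / 2"
      using cQ r(1) \<open>0 < e\<close> unfolding continuous_on_iff by (metis centre_in_ball half_gt_zero)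
    define d where "d = min r (min d1 d2)"
    \<comment> \<open>The summand 1 keeps the denominator positive when \<open>u\<close> and
      \<open>v\<close> vanish and makes h (|u| + |v|) < d strict.\<close>
    define h where "h = d / (norm u + norm v + 1)"
    have d: "0 < d" using r(1) d1(1) d2(1) by (simp add: d_def)
    have pos: "0 < norm u + norm v + 1"
      using norm_ge_zero[of u] norm_ge_zero[of v] by linarith
    have h: "0 < h" using d pos by (simp add: h_def)
    have hd: "h * (norm u + norm v) < d"
      using d pos by (simp add: h_def field_simps)
    have near: "dist (x + s *\<^sub>R u + t *\<^sub>R v) x < d" if "s \<in> {0<..<h}" "t \<in> {0<..<h}" for s t
    proof -
      have "norm (s *\<^sub>R u + t *\<^sub>R v) \<le> s * norm u + t * norm v"
        using that norm_triangle_ineq[of "s *\<^sub>R u" "t *\<^sub>R v"] by simp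
      also have "\<dots> \<le> h * norm u + h * norm v"
        using that by (intro add_mono mult_right_mono) auto
      finally show ?thesis
        using hd by (simp add: dist_norm algebra_simps)
    qed
    obtain s t where st: "s \<in> {0<..<h}" "t \<in> {0<..<h}"
      and P: "f (x + h *\<^sub>R u + h *\<^sub>R v) - f (x + h *\<^sub>R u) - f (x + h *\<^sub>R v) + f x =
        h * h * ?P (x + s *\<^sub>R u + t *\<^sub>R v)"
      using second_difference_mvt[OF sm h, of u v] hd by (auto simp: d_def)
    obtain s' t' where st': "s' \<in> {0<..<h}" "t' \<in> {0<..<h}"
      and Q: "f (x + h *\<^sub>R v + h *\<^sub>R u) - f (x + h *\<^sub>R v) - f (x + h *\<^sub>R u) + f x =
        h * h * ?Q (x + s' *\<^sub>R v + t' *\<^sub>R u)"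
      using second_difference_mvt[OF sm h, of v u] hd by (auto simp: d_def add.commute)
    have "h * h * ?P (x + s *\<^sub>R u + t *\<^sub>R v) = h * h * ?Q (x + s' *\<^sub>R v + t' *\<^sub>R u)"
      unfolding P[symmetric] Q[symmetric] by (simp add: algebra_simps)
    then have eq: "?P (x + s *\<^sub>R u + t *\<^sub>R v) = ?Q (x + t' *\<^sub>R u + s' *\<^sub>R v)"
      using h by (simp add: algebra_simps)
    have "dist (?P (x + s *\<^sub>R u + t *\<^sub>R v)) (?P x) < e / 2"
      using near[OF st] by (intro d1(2)) (auto simp: d_def dist_commute)
    moreover have "dist (?Q (x + t' *\<^sub>R u + s' *\<^sub>R v)) (?Q x) < e / 2"
      using near[OF st'(2,1)] by (intro d2(2)) (auto simp: d_def dist_commute)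
    ultimately show ?thesis
      unfolding eq by (metis dist_triangle_half_r)
  qed
  then show ?thesis
    using dist_pos_lt by blast
qed

text \<open>The mean value theorem with equality is a statement about real values, hence the
  reduction to coordinates of the codomain.\<close>

lemma symmetric_second_derivative:
  fixes f :: "'a::real_normed_vector \<Rightarrow> 'b::euclidean_space"
  assumes "open S" and "smooth_on S f" and "x \<in> S"
  shows "frechet_derivative (\<lambda>z. frechet_derivative f (at z) u) (at x) v =
    frechet_derivative (\<lambda>z. frechet_derivative f (at z) v) (at x) u"
proof (rule euclidean_eqI)
  fix b :: 'b
  have inner_frechet: "frechet_derivative (\<lambda>z. g z \<bullet> b) (at z) w = frechet_derivative g (at z) w \<bullet> b"
    if "smooth_on S g" "z \<in> S" for g :: "'a \<Rightarrow> 'b" and z w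
  proof -
    have "((\<lambda>z. g z \<bullet> b) has_derivative (\<lambda>w. frechet_derivative g (at z) w \<bullet> b)) (at z)"
      using smooth_on_has_derivative[OF that] by (rule has_derivative_inner_left)
    from frechet_derivative_at[OF this] show ?thesis by metis
  qed
  have second: "frechet_derivative (\<lambda>z. frechet_derivative f (at z) u) (at x) v \<bullet> b =
      frechet_derivative (\<lambda>z. frechet_derivative (\<lambda>z. f z \<bullet> b) (at z) u) (at x) v" for u v
  proof -
    have "frechet_derivative (\<lambda>z. frechet_derivative f (at z) u) (at x) v \<bullet> b =
        frechet_derivative (\<lambda>z. frechet_derivative f (at z) u \<bullet> b) (at x) v"
      using assms by (intro inner_frechet[symmetric] smooth_on_frechet)
    also have "frechet_derivative (\<lambda>z. frechet_derivative f (at z) u \<bullet> b) (at x) =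
        frechet_derivative (\<lambda>z. frechet_derivative (\<lambda>z. f z \<bullet> b) (at z) u) (at x)"
    proof (rule frechet_derivative_transform_within_open[OF _ assms(1,3)])
      show "(\<lambda>z. frechet_derivative f (at z) u \<bullet> b) differentiable at x"
        using assms
        by (intro smooth_on_differentiable[of S] smooth_on_bounded_linear[OF bounded_linear_inner_left]
            smooth_on_frechet)
    qed (simp add: inner_frechet assms(2))
    finally show ?thesis .
  qed
  have "smooth_on S (\<lambda>z. f z \<bullet> b)"
    using assms by (intro smooth_on_bounded_linear[OF bounded_linear_inner_left])
  from symmetric_second_derivative_real[OF assms(1) this assms(3), of u v]
  show "frechet_derivative (\<lambda>z. frechet_derivative f (at z) u) (at x) v \<bullet> b =
      frechet_derivative (\<lambda>z. frechet_derivative f (at z) v) (at x) u \<bullet> b"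
    by (simp add: second)
qed


section \<open>Bump functions\<close>

text \<open>With s = 1/t the functions p(s) exp(-s) form a family closed under differentiation, so
  smoothness is one induction over all \<open>p\<close>. The case \<open>p = 1\<close> is the
  classical flat function.\<close>

definition flat_poly :: "real poly \<Rightarrow> real \<Rightarrow> real" where
  "flat_poly p t = (if t > 0 then poly p (inverse t) * exp (- inverse t) else 0)"

lemma tendsto_poly_exp_0: "((\<lambda>s. poly p s * exp (- s)) \<longlongrightarrow> (0::real)) at_top"
proof -
  have "((\<lambda>s. \<Sum>i\<le>degree p. coeff p i * (s ^ i / exp s)) \<longlongrightarrow> (\<Sum>i\<le>degree p. coeff p i * 0)) at_top"
    by (intro tendsto_sum tendsto_mult tendsto_const tendsto_power_div_exp_0)
  then show ?thesis
    by (simp add: poly_altdef exp_minus divide_inverse sum_distrib_right mult.assoc)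
qed

lemma flat_poly_tendsto_0: "(flat_poly p \<longlongrightarrow> 0) (at 0)"
proof -
  have "((\<lambda>t. poly p (inverse t) * exp (- inverse t)) \<longlongrightarrow> 0) (at_right 0)"
    using filterlim_compose[OF tendsto_poly_exp_0 filterlim_inverse_at_top_right] .
  then have "(flat_poly p \<longlongrightarrow> 0) (at_right 0)"
    by (rule Lim_transform_eventually)
      (auto simp: flat_poly_def eventually_at_filter)
  moreover have "(flat_poly p \<longlongrightarrow> 0) (at_left 0)"
    by (rule Lim_transform_eventually[OF tendsto_const])
      (auto simp: flat_poly_def eventually_at_filter)
  ultimately show ?thesis
    by (simp add: filterlim_at_split)
qed

text \<open>For t > 0, d/dt is - s^2 d/ds with s = 1/t, whence the factor s^2 (p - p'). At 0 the
  difference quotient is again a member of the family, with one more factor s, and tends to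
  0.\<close>

lemma flat_poly_has_derivative:
  "(flat_poly p has_real_derivative flat_poly ([:0, 0, 1:] * (p - pderiv p)) t) (at t)"
proof (cases t "0 :: real" rule: linorder_cases)
  case less
  have "((\<lambda>t. 0) has_real_derivative 0) (at t)" by simp
  then have "(flat_poly p has_real_derivative 0) (at t)"
    by (rule has_field_derivative_transform_within_open[of _ _ _ "{..<0}"])
      (use less in \<open>auto simp: flat_poly_def\<close>)
  then show ?thesis using less by (simp add: flat_poly_def)
next
  case equal
  have "((\<lambda>h. (flat_poly p (0 + h) - flat_poly p 0) / h) \<longlongrightarrow> 0) (at 0)"
    by (rule Lim_transform_eventually[OF flat_poly_tendsto_0[of "pCons 0 p"]])
      (auto simp: flat_poly_def eventually_at_filter field_simps)
  then show ?thesis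
    using equal by (simp add: DERIV_def flat_poly_def)
next
  case greater
  have "((\<lambda>t. poly p (inverse t) * exp (- inverse t)) has_real_derivative
      flat_poly ([:0, 0, 1:] * (p - pderiv p)) t) (at t)"
    using greater
    by (auto intro!: derivative_eq_intros DERIV_chain2[OF poly_DERIV]
        simp: flat_poly_def field_simps power2_eq_square)
  then show ?thesis
    by (rule has_field_derivative_transform_within_open[of _ _ _ "{0<..}"])
      (use greater in \<open>auto simp: flat_poly_def\<close>)
qed

lemma smooth_on_flat_poly: "smooth_on UNIV (flat_poly p)"
proof -
  have "Ck_on n UNIV (flat_poly p)" for n
  proof (induction n arbitrary: p)
    case 0
    then show ?case
      using flat_poly_has_derivative
      by (auto intro!: continuous_at_imp_continuous_on DERIV_isCont)
  next
    case (Suc n)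
    show ?case
    proof (rule Ck_on_SucI[OF open_UNIV])
      show "(flat_poly p has_derivative (\<lambda>v. flat_poly ([:0, 0, 1:] * (p - pderiv p)) t * v)) (at t)" for t
        using flat_poly_has_derivative by (simp add: has_field_derivative_def)
      show "Ck_on n UNIV (\<lambda>t. flat_poly ([:0, 0, 1:] * (p - pderiv p)) t * v)" for v
        by (intro Ck_on_bounded_linear[OF bounded_linear_mult_left] Suc open_UNIV)
    qed
  qed
  then show ?thesis by (simp add: smooth_on_def)
qed

text \<open>The square is used because the norm itself is not smooth at \<open>a\<close>.\<close>

lemma smooth_on_norm_power2: "smooth_on UNIV (\<lambda>x::'a::euclidean_space. (norm (x - a))\<^sup>2)"
proof -
  have eq: "(norm (x - a))\<^sup>2 = (\<Sum>b\<in>Basis. ((x + - a) \<bullet> b) *\<^sub>R ((x + - a) \<bullet> b))" for x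
    unfolding power2_norm_eq_inner by (subst euclidean_inner) simp
  show ?thesis
    unfolding eq
    by (intro smooth_on_sum smooth_on_scaleR smooth_on_bounded_linear[OF bounded_linear_inner_left]
        smooth_on_add smooth_on_ident smooth_on_const open_UNIV)
qed

text \<open>With the flat function \<open>h(t) = exp(-1/t)\<close> and \<open>c\<close> the value of \<open>h\<close> at the end of the
  transition range, \<open>h(c - h(s))\<close> is constant for \<open>s \<le> 0\<close> and vanishes beyond that range.
  This avoids dividing by a sum of two such functions.\<close>

lemma smooth_bump:
  fixes a :: "'a::euclidean_space"
  assumes "0 < r" and "r < R"
  obtains \<phi> :: "'a \<Rightarrow> real" where "smooth_on UNIV \<phi>"
    and "\<And>x. x \<in> ball a r \<Longrightarrow> \<phi> x = 1" and "\<And>x. x \<notin> ball a R \<Longrightarrow> \<phi> x = 0"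
proof
  define c where "c = flat_poly 1 (R\<^sup>2 - r\<^sup>2)"
  have pos: "0 < R\<^sup>2 - r\<^sup>2" using assms by (simp add: power_strict_mono)
  then have c: "0 < c" by (simp add: c_def flat_poly_def)
  define \<phi> where "\<phi> x = flat_poly 1 (c + - flat_poly 1 ((norm (x - a))\<^sup>2 + - r\<^sup>2)) *\<^sub>R inverse (flat_poly 1 c)" for x :: 'a
  have minus: "smooth_on UNIV f \<Longrightarrow> smooth_on UNIV (\<lambda>x. - f x)" for f :: "'a \<Rightarrow> real"
    by (intro smooth_on_bounded_linear[OF bounded_linear_minus[OF bounded_linear_ident]] open_UNIV)
  have flat: "smooth_on UNIV f \<Longrightarrow> smooth_on UNIV (\<lambda>x. flat_poly 1 (f x))" for f :: "'a \<Rightarrow> real"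
    by (rule smooth_on_compose[OF open_UNIV open_UNIV _ _ smooth_on_flat_poly]) auto
  show "smooth_on UNIV \<phi>"
    unfolding \<phi>_def
    by (intro smooth_on_scaleR flat minus smooth_on_add smooth_on_const smooth_on_norm_power2 open_UNIV)
  show "\<phi> x = 1" if "x \<in> ball a r" for x
  proof -
    have "(norm (x - a))\<^sup>2 \<le> r\<^sup>2"
      using that by (intro power_mono) (auto simp: dist_norm norm_minus_commute)
    then have "flat_poly 1 ((norm (x - a))\<^sup>2 + - r\<^sup>2) = 0"
      by (simp add: flat_poly_def)
    then show ?thesis using c by (simp add: \<phi>_def) (simp add: flat_poly_def)
  qed
  show "\<phi> x = 0" if "x \<notin> ball a R" for x
  proof -
    have "R\<^sup>2 \<le> (norm (x - a))\<^sup>2"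
      using that assms by (intro power_mono) (auto simp: dist_norm norm_minus_commute)
    then have "R\<^sup>2 - r\<^sup>2 \<le> (norm (x - a))\<^sup>2 - r\<^sup>2" by simp
    then have "c \<le> flat_poly 1 ((norm (x - a))\<^sup>2 - r\<^sup>2)"
      using pos le_imp_inverse_le by (auto simp: c_def flat_poly_def)
    then show ?thesis by (simp add: \<phi>_def) (simp add: flat_poly_def)
  qed
qed


section \<open>Charts and tangent vectors\<close>

locale smooth_mfd =
  fixes M :: "'m topology" and A :: "('m, 'e::euclidean_space) chart set"
  assumes smooth_manifold: "smooth_manifold M A"
begin

lemma
  assumes "c \<in> A"
  shows openin_chart: "openin M (fst c)"
    and open_chart_range: "open (snd c ` fst c)"
    and homeomorphic_chart:
      "homeomorphic_map (subtopology M (fst c)) (top_of_set (snd c ` fst c)) (snd c)"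
  using smooth_manifold assms by (auto simp: smooth_manifold_def is_chart_def)

lemma ex_chart:
  assumes "p \<in> topspace M"
  obtains c where "c \<in> A" "p \<in> fst c"
  using smooth_manifold assms unfolding smooth_manifold_def by blast

lemma topspace_chart: "c \<in> A \<Longrightarrow> topspace (subtopology M (fst c)) = fst c"
  using openin_subset[OF openin_chart] by (simp add: Int_absorb1)

lemma inj_on_chart: "c \<in> A \<Longrightarrow> inj_on (snd c) (fst c)"
  using homeomorphic_imp_injective_map[OF homeomorphic_chart] by (metis topspace_chart)

lemma chart_inv_chart: "c \<in> A \<Longrightarrow> p \<in> fst c \<Longrightarrow> chart_inv c (snd c p) = p"
  by (simp add: chart_inv_def inj_on_chart)

lemma transition_chart: "c \<in> A \<Longrightarrow> p \<in> fst c \<Longrightarrow> transition c d (snd c p) = snd d p"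
  by (simp add: transition_def chart_inv_chart)

lemma local_rep_chart: "c \<in> A \<Longrightarrow> p \<in> fst c \<Longrightarrow> local_rep X c (snd c p) = X p c"
  by (simp add: local_rep_def chart_inv_chart)

lemma open_chart_image:
  assumes "c \<in> A" and "openin M U"
  shows "open (snd c ` (fst c \<inter> U))"
proof -
  have "openin (top_of_set (snd c ` fst c)) (snd c ` (fst c \<inter> U))"
    using homeomorphic_imp_open_map[OF homeomorphic_chart[OF assms(1)]] assms(2)
    by (simp add: open_map_def openin_subtopology_Int2)
  then show ?thesis
    using open_chart_range[OF assms(1)] openin_open_eq by blast
qed

lemma openin_chart_preimage:
  assumes "c \<in> A" and "open S"
  shows "openin M {q \<in> fst c. snd c q \<in> S}"
proof -
  have "continuous_map (subtopology M (fst c)) euclidean (snd c)"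
    using homeomorphic_imp_continuous_map[OF homeomorphic_chart[OF assms(1)]]
    by (simp add: continuous_map_in_subtopology)
  then have "openin (subtopology M (fst c)) {q \<in> topspace (subtopology M (fst c)). snd c q \<in> S}"
    by (rule openin_continuous_map_preimage) (simp add: assms(2))
  then have "openin (subtopology M (fst c)) {q \<in> fst c. snd c q \<in> S}"
    unfolding topspace_chart[OF assms(1)] .
  then show ?thesis
    using openin_chart[OF assms(1)] openin_trans_full by blast
qed

lemma open_overlap: "c \<in> A \<Longrightarrow> d \<in> A \<Longrightarrow> open (snd c ` (fst c \<inter> fst d))"
  by (simp add: open_chart_image openin_chart)

lemma smooth_on_transition:
  "c \<in> A \<Longrightarrow> d \<in> A \<Longrightarrow> smooth_on (snd c ` (fst c \<inter> fst d)) (transition c d)"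
  using smooth_manifold by (simp add: smooth_manifold_def)

abbreviation tchange :: "('m, 'e) chart \<Rightarrow> ('m, 'e) chart \<Rightarrow> 'm \<Rightarrow> 'e \<Rightarrow> 'e" where
  "tchange c d p \<equiv> frechet_derivative (transition c d) (at (snd c p))"

lemma transition_has_derivative:
  "c \<in> A \<Longrightarrow> d \<in> A \<Longrightarrow> p \<in> fst c \<Longrightarrow> p \<in> fst d \<Longrightarrow>
    (transition c d has_derivative tchange c d p) (at (snd c p))"
  using smooth_on_has_derivative[OF smooth_on_transition] by blast

lemma linear_tchange:
  "c \<in> A \<Longrightarrow> d \<in> A \<Longrightarrow> p \<in> fst c \<Longrightarrow> p \<in> fst d \<Longrightarrow> linear (tchange c d p)"
  using transition_has_derivative has_derivative_linear by blast

text \<open>Cocycle identity of the tangent bundle, by the chain rule: the composite of two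
  transitions agrees with the direct one on an open set around the point.\<close>

lemma tchange_comp:
  assumes "c \<in> A" "d \<in> A" "e \<in> A" "p \<in> fst c" "p \<in> fst d" "p \<in> fst e"
  shows "tchange d e p (tchange c d p v) = tchange c e p v"
proof -
  have "((\<lambda>x. transition d e (transition c d x)) has_derivative (\<lambda>v. tchange d e p (tchange c d p v)))
      (at (snd c p))"
    using has_derivative_compose[OF transition_has_derivative[of c d p]
        transition_has_derivative[of d e p, folded transition_chart[OF assms(1,4), of d]]] assms
    by (simp add: transition_chart)
  then have "(transition c e has_derivative (\<lambda>v. tchange d e p (tchange c d p v))) (at (snd c p))"
  proof (rule has_derivative_transform_within_open)
    show "open (snd c ` (fst c \<inter> fst d))" using assms by (simp add: open_overlap)
  qed (use assms in \<open>auto simp: transition_chart\<close>)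
  from frechet_derivative_at[OF this] show ?thesis by metis
qed

lemma tchange_self:
  assumes "c \<in> A" "p \<in> fst c"
  shows "tchange c c p v = v"
proof -
  have "((\<lambda>x. x) has_derivative (\<lambda>v. v)) (at (snd c p))" by simp
  then have "(transition c c has_derivative (\<lambda>v. v)) (at (snd c p))"
    by (rule has_derivative_transform_within_open[OF _ open_chart_range[OF assms(1)]])
      (use assms in \<open>auto simp: transition_chart\<close>)
  from frechet_derivative_at[OF this] show ?thesis by metis
qed

lemma tangent_space_change:
  "u \<in> tangent_space A p \<Longrightarrow> c \<in> A \<Longrightarrow> d \<in> A \<Longrightarrow> p \<in> fst c \<Longrightarrow> p \<in> fst d \<Longrightarrow>
    u d = tchange c d p (u c)"
  unfolding tangent_space_def by blast

lemma tangent_spaceI: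
  assumes "\<And>c. \<not> (c \<in> A \<and> p \<in> fst c) \<Longrightarrow> u c = 0"
    and "\<And>c d. c \<in> A \<Longrightarrow> d \<in> A \<Longrightarrow> p \<in> fst c \<Longrightarrow> p \<in> fst d \<Longrightarrow> u d = tchange c d p (u c)"
  shows "u \<in> tangent_space A p"
  unfolding tangent_space_def using assms by blast

lemma tangent_space_outside:
  "u \<in> tangent_space A p \<Longrightarrow> \<not> (c \<in> A \<and> p \<in> fst c) \<Longrightarrow> u c = 0"
  unfolding tangent_space_def by blast

lemma subspace_tangent_space: "subspace (tangent_space A p)"
proof (rule subspaceI; (rule tangent_spaceI)?)
  fix u v :: "('m, 'e) tvec" and a :: real and c d
  show "(0 :: ('m, 'e) tvec) c = 0" by simp
  show "(u + v) c = 0" if "u \<in> tangent_space A p" "v \<in> tangent_space A p" "\<not> (c \<in> A \<and> p \<in> fst c)"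
    using tangent_space_outside[OF that(1,3)] tangent_space_outside[OF that(2,3)] by simp
  show "(a *\<^sub>R u) c = 0" if "u \<in> tangent_space A p" "\<not> (c \<in> A \<and> p \<in> fst c)"
    using tangent_space_outside[OF that] by (simp add: scaleR_fun_def)
  assume cd: "c \<in> A" "d \<in> A" "p \<in> fst c" "p \<in> fst d"
  note lin = linear_tchange[OF cd]
  show "(0 :: ('m, 'e) tvec) d = tchange c d p ((0 :: ('m, 'e) tvec) c)"
    by (simp add: linear_0[OF lin])
  show "(u + v) d = tchange c d p ((u + v) c)" if "u \<in> tangent_space A p" "v \<in> tangent_space A p"
    using tangent_space_change[OF that(1) cd] tangent_space_change[OF that(2) cd]
    by (simp add: linear_add[OF lin])
  show "(a *\<^sub>R u) d = tchange c d p ((a *\<^sub>R u) c)" if "u \<in> tangent_space A p"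
    using tangent_space_change[OF that cd] by (simp add: linear_cmul[OF lin] scaleR_fun_def)
qed

lemma coord_vec_chart: "c \<in> A \<Longrightarrow> p \<in> fst c \<Longrightarrow> coord_vec A c v p c = v"
  by (simp add: coord_vec_def tchange_self)

lemma coord_vec_tangent: "c \<in> A \<Longrightarrow> p \<in> fst c \<Longrightarrow> coord_vec A c v p \<in> tangent_space A p"
  by (rule tangent_spaceI) (auto simp: coord_vec_def tchange_comp)

text \<open>Together with \<open>coord_vec_chart\<close> this identifies the tangent space with the
  model space. At charts not around \<open>p\<close> both sides are 0 by convention.\<close>

lemma coord_vec_eq:
  assumes "c \<in> A" "p \<in> fst c" "u \<in> tangent_space A p"
  shows "coord_vec A c (u c) p = u"
proof
  show "coord_vec A c (u c) p d = u d" for d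
    using tangent_space_outside[OF assms(3), of d] tangent_space_change[OF assms(3,1) _ assms(2), of d]
    by (auto simp: coord_vec_def)
qed

lemma linear_coord_vec:
  assumes "c \<in> A" "p \<in> fst c"
  shows "linear (\<lambda>v. coord_vec A c v p)"
  by (rule linearI)
    (use assms linear_tchange[of c _ p] in
      \<open>auto simp: fun_eq_iff coord_vec_def scaleR_fun_def linear_add linear_cmul\<close>)


section \<open>Vector fields\<close>

lemma vector_field_tangent: "vector_field A U X \<Longrightarrow> p \<in> U \<Longrightarrow> X p \<in> tangent_space A p"
  by (simp add: vector_field_def)

lemma vector_field_smooth:
  "vector_field A U X \<Longrightarrow> c \<in> A \<Longrightarrow> smooth_on (snd c ` (fst c \<inter> U)) (local_rep X c)"
  by (simp add: vector_field_def)

text \<open>Components in another chart are the derivative of a transition applied to the given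
  components, both pulled back by the inverse transition, so one chart suffices.\<close>

lemma vector_field_in_chartI:
  assumes "c \<in> A" and "openin M U" and "U \<subseteq> fst c"
    and tangent: "\<And>p. p \<in> U \<Longrightarrow> X p \<in> tangent_space A p"
    and smooth: "smooth_on (snd c ` U) (local_rep X c)"
  shows "vector_field A U X"
  unfolding vector_field_def
proof (intro conjI ballI tangent)
  fix d assume d: "d \<in> A"
  let ?S = "snd d ` (fst d \<inter> U)" and ?\<psi> = "transition d c"
  have S: "open ?S" using d assms(2) by (rule open_chart_image)
  have sm\<psi>: "smooth_on ?S ?\<psi>"
    by (rule smooth_on_subset[OF smooth_on_transition[OF d assms(1)]]) (use assms(3) in auto)
  have U: "open (snd c ` U)"
    using open_chart_image[OF assms(1,2)] assms(3) by (simp add: Int_absorb1)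
  have "smooth_on ?S (\<lambda>y. frechet_derivative (transition c d) (at (?\<psi> y)) (local_rep X c (?\<psi> y)))"
  proof (rule smooth_on_linear_apply[OF S, where L = "\<lambda>y. frechet_derivative (transition c d) (at (?\<psi> y))"])
    show "linear (frechet_derivative (transition c d) (at (?\<psi> y)))" if "y \<in> ?S" for y
      using that assms(1,3) d by (auto simp: transition_chart intro!: linear_tchange)
    show "smooth_on ?S (\<lambda>y. frechet_derivative (transition c d) (at (?\<psi> y)) b)" for b
      by (rule smooth_on_compose[OF S open_overlap[OF assms(1) d] _ sm\<psi>
            smooth_on_frechet[OF smooth_on_transition[OF assms(1) d]]])
        (use assms(3) d in \<open>auto simp: transition_chart\<close>)
    show "smooth_on ?S (\<lambda>y. local_rep X c (?\<psi> y))"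
      by (rule smooth_on_compose[OF S U _ sm\<psi> smooth])
        (use d in \<open>auto simp: transition_chart\<close>)
  qed
  then show "smooth_on ?S (local_rep X d)"
  proof (rule smooth_on_cong[OF S, rotated])
    fix y assume "y \<in> ?S"
    then obtain q where q: "q \<in> fst d" "q \<in> U" "y = snd d q" by auto
    then show "frechet_derivative (transition c d) (at (?\<psi> y)) (local_rep X c (?\<psi> y)) = local_rep X d y"
      using tangent_space_change[OF tangent[OF q(2)] assms(1) d] assms(1,3) d
      by (auto simp: transition_chart local_rep_chart)
  qed
qed

lemma vector_field_subset: "vector_field A U X \<Longrightarrow> V \<subseteq> U \<Longrightarrow> vector_field A V X"
  unfolding vector_field_def by (blast intro: smooth_on_subset)

lemma vector_field_cong:
  assumes "openin M U" and "\<And>p. p \<in> U \<Longrightarrow> X p = Y p" and "vector_field A U X"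
  shows "vector_field A U Y"
  unfolding vector_field_def
proof (intro conjI ballI)
  show "Y p \<in> tangent_space A p" if "p \<in> U" for p
    using vector_field_tangent[OF assms(3) that] assms(2) that by simp
  show "smooth_on (snd c ` (fst c \<inter> U)) (local_rep Y c)" if "c \<in> A" for c
    by (rule smooth_on_cong[OF open_chart_image[OF that assms(1)] _ vector_field_smooth[OF assms(3) that]])
      (use that assms(2) in \<open>auto simp: local_rep_chart\<close>)
qed

lemma vector_field_Un:
  assumes "openin M U" "openin M V" "vector_field A U X" "vector_field A V X"
  shows "vector_field A (U \<union> V) X"
  using assms unfolding vector_field_def
  by (auto simp: Int_Un_distrib image_Un intro!: smooth_on_Un open_chart_image)

lemma vector_field_zero: "openin M U \<Longrightarrow> vector_field A U (\<lambda>p. 0)"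
  unfolding vector_field_def
  using subspace_0[OF subspace_tangent_space]
  by (auto simp: local_rep_def intro!: smooth_on_const open_chart_image)

lemma vector_field_add:
  assumes "openin M U" "vector_field A U X" "vector_field A U Y"
  shows "vector_field A U (\<lambda>p. X p + Y p)"
  using assms unfolding vector_field_def
  by (auto simp: local_rep_def intro!: smooth_on_add open_chart_image subspace_add[OF subspace_tangent_space])

lemma vector_field_scaleR:
  assumes "openin M U" "vector_field A U X"
  shows "vector_field A U (\<lambda>p. a *\<^sub>R X p)"
  using assms unfolding vector_field_def
  by (auto simp: local_rep_def scaleR_fun_def[of a "X _"] intro!: smooth_on_scaleR smooth_on_const
      open_chart_image subspace_scale[OF subspace_tangent_space, unfolded scaleR_fun_def])

lemma vector_field_minus:
  "openin M U \<Longrightarrow> vector_field A U X \<Longrightarrow> vector_field A U (\<lambda>p. - X p)"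
  using vector_field_scaleR[of U X "-1"] by simp

lemma vector_field_coord_vec:
  assumes "c \<in> A"
  shows "vector_field A (fst c) (coord_vec A c v)"
proof (rule vector_field_in_chartI[OF assms openin_chart[OF assms] subset_refl])
  show "smooth_on (snd c ` fst c) (local_rep (coord_vec A c v) c)"
    by (rule smooth_on_cong[OF _ _ smooth_on_const[where c = v]])
      (use assms in \<open>auto simp: open_chart_range local_rep_chart coord_vec_chart\<close>)
qed (simp add: assms coord_vec_tangent)

section \<open>Tensor fields acting on vector fields\<close>

lemma
  assumes "tensor_field11 M A T" and "p \<in> topspace M" and "u \<in> tangent_space A p"
  shows tensor_tangent: "T p u \<in> tangent_space A p"
    and tensor_add: "v \<in> tangent_space A p \<Longrightarrow> T p (u + v) = T p u + T p v"
    and tensor_scaleR: "T p (a *\<^sub>R u) = a *\<^sub>R T p u"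
  using assms unfolding tensor_field11_def by blast+

lemma tensor_minus:
  "tensor_field11 M A T \<Longrightarrow> p \<in> topspace M \<Longrightarrow> u \<in> tangent_space A p \<Longrightarrow> T p (- u) = - T p u"
  using tensor_scaleR[of T p u "-1"] by simp

lemma tensor_zero: "tensor_field11 M A T \<Longrightarrow> p \<in> topspace M \<Longrightarrow> T p 0 = 0"
  using tensor_scaleR[of T p 0 0] subspace_0[OF subspace_tangent_space] by simp

lemma linear_tensor_coords:
  assumes "tensor_field11 M A T" and "c \<in> A" "p \<in> fst c"
  shows "linear (\<lambda>v. T p (coord_vec A c v p) c)"
proof -
  have "p \<in> topspace M" using openin_chart[OF assms(2)] assms(3) openin_subset by blast
  then show ?thesis
    using linear_add[OF linear_coord_vec[OF assms(2,3)]] linear_cmul[OF linear_coord_vec[OF assms(2,3)]] assms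
    by (intro linearI) (simp_all add: tensor_add tensor_scaleR coord_vec_tangent, simp add: scaleR_fun_def)
qed

text \<open>The smoothness condition on \<open>T\<close> only tests coordinate fields; linearity of
  \<open>T\<close> at each point lets a general field be expanded in them.\<close>

lemma vector_field_tensor:
  assumes T: "tensor_field11 M A T" and U: "openin M U" and X: "vector_field A U X"
  shows "vector_field A U (\<lambda>q. T q (X q))"
  unfolding vector_field_def
proof (intro conjI ballI)
  show "T p (X p) \<in> tangent_space A p" if "p \<in> U" for p
    using that vector_field_tangent[OF X] openin_subset[OF U] by (auto intro: tensor_tangent[OF T])
  fix c assume c: "c \<in> A"
  let ?S = "snd c ` (fst c \<inter> U)"
  let ?L = "\<lambda>x v. local_rep (\<lambda>p. T p (coord_vec A c v p)) c x"
  have S: "open ?S" using c U by (rule open_chart_image)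
  have "smooth_on ?S (\<lambda>x. ?L x (local_rep X c x))"
  proof (rule smooth_on_linear_apply[OF S _ _ vector_field_smooth[OF X c]])
    show "linear (?L x)" if "x \<in> ?S" for x
      using that c by (auto simp: local_rep_chart intro!: linear_tensor_coords[OF T])
    show "smooth_on ?S (\<lambda>x. ?L x b)" for b
      using T c unfolding tensor_field11_def by (blast intro: smooth_on_subset[where S = "snd c ` fst c"])
  qed
  then show "smooth_on ?S (local_rep (\<lambda>q. T q (X q)) c)"
    by (rule smooth_on_cong[OF S, rotated])
      (use c vector_field_tangent[OF X] in \<open>auto simp: local_rep_chart coord_vec_eq\<close>)
qed

section \<open>Extension of local vector fields\<close>

lemma vector_field_bump:
  assumes "c \<in> A" and "openin M U" and "U \<subseteq> fst c" and "smooth_on UNIV \<phi>" and "vector_field A U X"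
  shows "vector_field A U (\<lambda>q. \<phi> (snd c q) *\<^sub>R X q)"
proof (rule vector_field_in_chartI[OF assms(1-3)])
  show "\<phi> (snd c p) *\<^sub>R X p \<in> tangent_space A p" if "p \<in> U" for p
    using vector_field_tangent[OF assms(5) that] by (rule subspace_scale[OF subspace_tangent_space])
  have U: "fst c \<inter> U = U" using assms(3) by auto
  have op: "open (snd c ` U)" using open_chart_image[OF assms(1,2)] by (simp add: U)
  have "smooth_on (snd c ` U) (\<lambda>x. \<phi> x *\<^sub>R local_rep X c x)"
    using vector_field_smooth[OF assms(5,1)] assms(4)
    by (intro smooth_on_scaleR op) (auto simp: U intro: smooth_on_subset)
  then show "smooth_on (snd c ` U) (local_rep (\<lambda>q. \<phi> (snd c q) *\<^sub>R X q) c)"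
    by (rule smooth_on_cong[OF op, rotated])
      (use assms(1,3) in \<open>auto simp: local_rep_chart scaleR_fun_def\<close>)
qed

text \<open>The field is multiplied by a bump function in a chart and continued by 0. Smoothness is
  checked on two open sets covering the manifold: \<open>V\<close> and the complement of a compact
  set containing the support.\<close>

lemma vector_field_extension:
  assumes "openin M U" and X: "vector_field A U X" and "p \<in> U"
  obtains X' W where "vector_field A (topspace M) X'" and "openin M W" and "p \<in> W" and "W \<subseteq> U"
    and "\<And>q. q \<in> W \<Longrightarrow> X' q = X q"
proof -
  have "p \<in> topspace M" using assms(1,3) openin_subset by blast
  then obtain c where c: "c \<in> A" "p \<in> fst c" by (rule ex_chart)
  define V where "V = fst c \<inter> U"
  have V: "openin M V" "V \<subseteq> fst c" "V \<subseteq> U" "p \<in> V"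
    using openin_chart[OF c(1)] assms c by (auto simp: V_def)
  have "open (snd c ` V)"
    unfolding V_def using c(1) assms(1) by (rule open_chart_image)
  then obtain R where R: "0 < R" "cball (snd c p) R \<subseteq> snd c ` V"
    using V(4) open_contains_cball by blast
  obtain \<phi> where \<phi>: "smooth_on UNIV \<phi>" "\<And>x. x \<in> ball (snd c p) (R / 2) \<Longrightarrow> \<phi> x = (1::real)"
    "\<And>x. x \<notin> ball (snd c p) R \<Longrightarrow> \<phi> x = 0"
    using smooth_bump[of "R / 2" R "snd c p"] R(1) by auto
  define X' where "X' = (\<lambda>q. if q \<in> V then \<phi> (snd c q) *\<^sub>R X q else 0)"
  \<comment> \<open>Preimage of a closed ball, compact through the chart. The Hausdorff property
    makes it closed, so its complement is open.\<close>
  define B where "B = {q \<in> V. snd c q \<in> cball (snd c p) R}"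
  have "snd c ` B = cball (snd c p) R" using R(2) by (auto simp: B_def)
  then have "compactin (top_of_set (snd c ` fst c)) (snd c ` B)"
    using order_trans[OF R(2) image_mono[OF V(2)]] by (simp add: compactin_subtopology)
  moreover have "B \<subseteq> topspace (subtopology M (fst c))"
    unfolding topspace_chart[OF c(1)] using V(2) by (auto simp: B_def)
  ultimately have "compactin (subtopology M (fst c)) B"
    using homeomorphic_map_compactness_eq[OF homeomorphic_chart[OF c(1)]] by blast
  then have "compactin M B" by (simp add: compactin_subtopology)
  moreover have "Hausdorff_space M" using smooth_manifold by (simp add: smooth_manifold_def)
  ultimately have "closedin M B" by (rule compactin_imp_closedin[rotated])
  then have MB: "openin M (topspace M - B)" by blast
  have "vector_field A (V \<union> (topspace M - B)) X'"
  proof (rule vector_field_Un[OF V(1) MB])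
    show "vector_field A V X'"
      by (rule vector_field_cong[OF V(1) _ vector_field_bump[OF c(1) V(1,2) \<phi>(1) vector_field_subset[OF X V(3)]]])
        (simp add: X'_def)
    show "vector_field A (topspace M - B) X'"
      by (rule vector_field_cong[OF MB _ vector_field_zero[OF MB]]) (auto simp: X'_def B_def \<phi>(3))
  qed
  moreover have "V \<union> (topspace M - B) = topspace M"
    using openin_subset[OF V(1)] by (auto simp: B_def)
  ultimately have X'': "vector_field A (topspace M) X'" by simp
  show thesis
  proof (rule that[OF X''])
    \<comment> \<open>On the inner ball the bump function is 1, so the extension keeps the germ of
      \<open>X\<close> at \<open>p\<close>.\<close>
    let ?W = "{q \<in> fst c. snd c q \<in> ball (snd c p) (R / 2)} \<inter> V"
    show "openin M ?W" using openin_chart_preimage[OF c(1)] V(1) by blast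
    show "p \<in> ?W" "?W \<subseteq> U" using c V R(1) by auto
    show "X' q = X q" if "q \<in> ?W" for q
      using that by (simp add: X'_def \<phi>(2))
  qed
qed


section \<open>The Lie bracket\<close>

lemma local_rep_has_derivative:
  assumes "vector_field A U X" "c \<in> A" "p \<in> fst c" "p \<in> U"
  shows "(local_rep X c has_derivative frechet_derivative (local_rep X c) (at (snd c p))) (at (snd c p))"
  using smooth_on_has_derivative[OF vector_field_smooth[OF assms(1,2)]] assms(3,4) by auto

lemma local_rep_differentiable:
  "vector_field A U X \<Longrightarrow> c \<in> A \<Longrightarrow> p \<in> fst c \<Longrightarrow> p \<in> U \<Longrightarrow> local_rep X c differentiable (at (snd c p))"
  using local_rep_has_derivative differentiableI by blast

lemma frechet_local_rep_cong:
  assumes "openin M U" "vector_field A U X" "\<And>q. q \<in> U \<Longrightarrow> X q = Y q" "c \<in> A" "p \<in> fst c" "p \<in> U"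
  shows "frechet_derivative (local_rep X c) (at (snd c p)) = frechet_derivative (local_rep Y c) (at (snd c p))"
proof (rule frechet_derivative_transform_within_open)
  show "open (snd c ` (fst c \<inter> U))" using assms(4,1) by (rule open_chart_image)
  show "local_rep X c differentiable at (snd c p)"
    using assms(2,4,5,6) by (rule local_rep_differentiable)
qed (use assms in \<open>auto simp: local_rep_chart\<close>)

text \<open>The bracket depends on germs only. This serves both for passing to global extensions and
  for identities such as T (T X) = - X that hold on \<open>U\<close> only.\<close>

lemma lie_bracket_cong:
  assumes "openin M U" "vector_field A U X" "vector_field A U Y" "p \<in> U"
    and "\<And>q. q \<in> U \<Longrightarrow> X q = X' q" and "\<And>q. q \<in> U \<Longrightarrow> Y q = Y' q"
  shows "lie_bracket A X Y p = lie_bracket A X' Y' p"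
  using frechet_local_rep_cong[OF assms(1,2,5)] frechet_local_rep_cong[OF assms(1,3,6)] assms(4-6)
  by (auto simp: lie_bracket_def fun_eq_iff)

lemma frechet_local_rep_minus:
  assumes "vector_field A U X" "c \<in> A" "p \<in> fst c" "p \<in> U"
  shows "frechet_derivative (local_rep (\<lambda>q. - X q) c) (at (snd c p)) v =
    - frechet_derivative (local_rep X c) (at (snd c p)) v"
proof -
  have "(local_rep (\<lambda>q. - X q) c has_derivative (\<lambda>v. - frechet_derivative (local_rep X c) (at (snd c p)) v))
      (at (snd c p))"
    using has_derivative_minus[OF local_rep_has_derivative[OF assms]] by (simp add: local_rep_def)
  from frechet_derivative_at[OF this] show ?thesis by metis
qed

lemma lie_bracket_minus_right:
  assumes "vector_field A U X" "vector_field A U Y" "p \<in> U"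
  shows "lie_bracket A X (\<lambda>q. - Y q) p = - lie_bracket A X Y p"
proof
  fix c
  show "lie_bracket A X (\<lambda>q. - Y q) p c = (- lie_bracket A X Y p) c"
    using frechet_local_rep_minus[OF assms(2), of c p] assms(3)
      linear_neg[OF has_derivative_linear[OF local_rep_has_derivative[OF assms(1), of c p]]]
    by (simp add: lie_bracket_def)
qed

lemma lie_bracket_antisym: "lie_bracket A X Y p = - lie_bracket A Y X p"
  by (simp add: lie_bracket_def fun_eq_iff)

lemma lie_bracket_minus_left:
  assumes "vector_field A U X" "vector_field A U Y" "p \<in> U"
  shows "lie_bracket A (\<lambda>q. - X q) Y p = - lie_bracket A X Y p"
  using lie_bracket_minus_right[OF assms(2,1,3)] lie_bracket_antisym by metis

text \<open>Differentiating the transformation law of the components produces a second derivative of the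
  transition map, which cancels in the bracket because it is symmetric.\<close>

lemma lie_bracket_tangent:
  assumes U: "openin M U" and X: "vector_field A U X" and Y: "vector_field A U Y" and p: "p \<in> U"
  shows "lie_bracket A X Y p \<in> tangent_space A p"
proof -
  have law: "lie_bracket A X Y p d = tchange c d p (lie_bracket A X Y p c)"
    if c: "c \<in> A" "p \<in> fst c" and d: "d \<in> A" "p \<in> fst d" for c d
  proof -
    let ?\<psi> = "transition c d" and ?x = "snd c p"
    let ?D = "\<lambda>z. frechet_derivative ?\<psi> (at z)"
    let ?D2 = "\<lambda>v. frechet_derivative (\<lambda>z. ?D z v) (at ?x)"
    let ?S = "snd c ` (fst c \<inter> (fst d \<inter> U))"
    have S: "open ?S" using c(1) U openin_chart[OF d(1)] by (intro open_chart_image) auto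
    have sm: "smooth_on ?S ?\<psi>"
      by (rule smooth_on_subset[OF smooth_on_transition[OF c(1) d(1)]]) auto
    have x: "?x \<in> ?S" using c d p by auto
    have lin: "linear (?D z)" if "z \<in> ?S" for z
      using smooth_on_has_derivative[OF sm that] by (rule has_derivative_linear)
    \<comment> \<open>Derivative, in direction \<open>w\<close>, of the transformation law of the
      components of \<open>Z\<close>.\<close>
    have change: "frechet_derivative (local_rep Z d) (at (snd d p)) (?D ?x w) =
        ?D2 (Z p c) w + ?D ?x (frechet_derivative (local_rep Z c) (at ?x) w)"
      if Z: "vector_field A U Z" for Z w
    proof -
      note Zc = local_rep_has_derivative[OF Z c p] and Zd = local_rep_has_derivative[OF Z d p]
      let ?Zc' = "frechet_derivative (local_rep Z c) (at ?x)"
      \<comment> \<open>Expansion in a basis reduces the product rule for operator times vector to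
        the one for scalar times vector.\<close>
      have "((\<lambda>z. \<Sum>b\<in>Basis. (local_rep Z c z \<bullet> b) *\<^sub>R ?D z b) has_derivative
          (\<lambda>w. \<Sum>b\<in>Basis. (local_rep Z c ?x \<bullet> b) *\<^sub>R ?D2 b w + (?Zc' w \<bullet> b) *\<^sub>R ?D ?x b)) (at ?x)"
        by (intro has_derivative_sum has_derivative_scaleR has_derivative_inner_left Zc
            smooth_on_has_derivative[OF smooth_on_frechet[OF sm] x])
      moreover have "(\<Sum>b\<in>Basis. (local_rep Z c z \<bullet> b) *\<^sub>R ?D z b) = local_rep Z d (?\<psi> z)"
        if z: "z \<in> ?S" for z
      proof -
        obtain q where q: "q \<in> fst c" "q \<in> fst d" "q \<in> U" "z = snd c q" using z by auto
        then show ?thesis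
          unfolding linear_eq_sum_Basis[OF lin[OF z], symmetric]
          using tangent_space_change[OF vector_field_tangent[OF Z q(3)] c(1) d(1) q(1,2)] c(1) d(1)
          by (simp add: transition_chart local_rep_chart)
      qed
      ultimately have 1: "((\<lambda>z. local_rep Z d (?\<psi> z)) has_derivative
          (\<lambda>w. \<Sum>b\<in>Basis. (local_rep Z c ?x \<bullet> b) *\<^sub>R ?D2 b w + (?Zc' w \<bullet> b) *\<^sub>R ?D ?x b)) (at ?x)"
        by (rule has_derivative_transform_within_open[OF _ S x])
      have 2: "((\<lambda>z. local_rep Z d (?\<psi> z)) has_derivative
          (\<lambda>w. frechet_derivative (local_rep Z d) (at (snd d p)) (?D ?x w))) (at ?x)"
        using has_derivative_compose[OF smooth_on_has_derivative[OF sm x]] Zd c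
        by (simp add: transition_chart)
      \<comment> \<open>Freezing the components at their value at \<open>p\<close> isolates the term
        with second derivatives.\<close>
      have "((\<lambda>z. \<Sum>b\<in>Basis. (Z p c \<bullet> b) *\<^sub>R ?D z b) has_derivative
          (\<lambda>w. \<Sum>b\<in>Basis. (Z p c \<bullet> b) *\<^sub>R ?D2 b w)) (at ?x)"
        by (intro has_derivative_sum has_derivative_scaleR_right
            smooth_on_has_derivative[OF smooth_on_frechet[OF sm] x])
      then have "((\<lambda>z. ?D z (Z p c)) has_derivative
          (\<lambda>w. \<Sum>b\<in>Basis. (Z p c \<bullet> b) *\<^sub>R ?D2 b w)) (at ?x)"
        by (rule has_derivative_transform_within_open[OF _ S x])
          (rule linear_eq_sum_Basis[OF lin, symmetric], assumption)
      from fun_cong[OF frechet_derivative_at[OF this], of w]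
      have 3: "?D2 (Z p c) w = (\<Sum>b\<in>Basis. (Z p c \<bullet> b) *\<^sub>R ?D2 b w)" by (rule sym)
      show ?thesis
        using fun_cong[OF has_derivative_unique[OF 2 1], of w] 3 c
        by (simp add: local_rep_chart sum.distrib linear_eq_sum_Basis[OF lin[OF x], symmetric])
    qed
    have "?D2 (Y p c) (X p c) = ?D2 (X p c) (Y p c)"
      by (rule symmetric_second_derivative[OF S sm x])
    then show ?thesis
      using change[OF Y, of "X p c"] change[OF X, of "Y p c"] c d
        tangent_space_change[OF vector_field_tangent[OF X p] c(1) d(1) c(2) d(2)]
        tangent_space_change[OF vector_field_tangent[OF Y p] c(1) d(1) c(2) d(2)]
      by (simp add: lie_bracket_def linear_diff[OF lin[OF x]])
  qed
  show ?thesis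
  proof (rule tangent_spaceI)
    show "lie_bracket A X Y p c = 0" if "\<not> (c \<in> A \<and> p \<in> fst c)" for c
      using that by (auto simp: lie_bracket_def)
  qed (rule law)
qed

text \<open>Every bracket in the Nijenhuis tensor sees only germs at \<open>p\<close>, so the local
  fields may be exchanged for global ones with the same germs, to which the hypothesis
  applies.\<close>

lemma nijenhuis_eq_0:
  assumes T: "tensor_field11 M A T" and N: "integrable_tensor M A T"
    and U: "openin M U" and X: "vector_field A U X" and Y: "vector_field A U Y" and p: "p \<in> U"
  shows "nijenhuis A T X Y p = 0"
proof -
  obtain X' V where X': "vector_field A (topspace M) X'" "openin M V" "p \<in> V" "V \<subseteq> U"
    "\<And>q. q \<in> V \<Longrightarrow> X' q = X q"
    using vector_field_extension[OF U X p] by blast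
  obtain Y' W where Y': "vector_field A (topspace M) Y'" "openin M W" "p \<in> W" "W \<subseteq> U"
    "\<And>q. q \<in> W \<Longrightarrow> Y' q = Y q"
    using vector_field_extension[OF U Y p] by blast
  have VW: "openin M (V \<inter> W)" "p \<in> V \<inter> W" "V \<inter> W \<subseteq> topspace M"
    using X' Y' openin_subset by blast+
  note fields = vector_field_subset[OF X'(1) VW(3)] vector_field_subset[OF Y'(1) VW(3)]
  have eq: "lie_bracket A X1 Y1 p = lie_bracket A X2 Y2 p"
    if "vector_field A (V \<inter> W) X1" "vector_field A (V \<inter> W) Y1"
      "\<And>q. q \<in> V \<inter> W \<Longrightarrow> X1 q = X2 q" "\<And>q. q \<in> V \<inter> W \<Longrightarrow> Y1 q = Y2 q" for X1 X2 Y1 Y2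
    using VW(1) that(1,2) VW(2) that(3,4) by (rule lie_bracket_cong)
  have "nijenhuis A T X' Y' p = nijenhuis A T X Y p"
    unfolding nijenhuis_def
    using X'(5) Y'(5)
    by (auto intro!: arg_cong2[of _ _ _ _ plus] arg_cong2[of _ _ _ _ minus] arg_cong[of _ _ "T p"] eq
        vector_field_tensor[OF T VW(1)] fields)
  moreover have "nijenhuis A T X' Y' p = 0"
    using N X'(1) Y'(1) VW unfolding integrable_tensor_def by blast
  ultimately show ?thesis by simp
qed

end


section \<open>Complex linear algebra on pairs\<close>

lemma cscale_Complex: "cscale (Complex a b) z = a *\<^sub>R z + b *\<^sub>R cscale \<i> z"
  by (simp add: cscale_def prod_eq_iff)

lemma cplx_subspace_imp_subspace: "cplx.subspace S \<Longrightarrow> subspace S"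
proof (rule subspaceI)
  assume S: "cplx.subspace S"
  show "0 \<in> S" using S by (rule cplx.subspace_0)
  show "x + y \<in> S" if "x \<in> S" "y \<in> S" for x y using S that by (rule cplx.subspace_add)
  show "a *\<^sub>R x \<in> S" if "x \<in> S" for a x
    using cplx.subspace_scale[OF S that, of "complex_of_real a"]
    by (simp add: cscale_def scaleR_prod_def)
qed

lemma module_hom_map_prod: "linear f \<Longrightarrow> module_hom cscale cscale (map_prod f f)"
  by unfold_locales (auto simp: cscale_def linear_add linear_diff linear_cmul algebra_simps)

text \<open>A real combination of vectors z and j z is a complex combination with coefficients a + j
  b. The doubling transfers real dimension theory to complex bases.\<close>

lemma cplx_independent_imp_real:
  assumes "finite B" and "cplx.independent B"
  shows "independent (B \<union> cscale \<i> ` B)" and "card (B \<union> cscale \<i> ` B) = 2 * card B"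
proof -
  have coeffs: "a z = 0 \<and> b z = 0"
    if sum: "(\<Sum>z\<in>B. a z *\<^sub>R z) + (\<Sum>z\<in>B. b z *\<^sub>R cscale \<i> z) = 0" and z: "z \<in> B" for a b z
  proof -
    have "(\<Sum>z\<in>B. cscale (Complex (a z) (b z)) z) = 0"
      using sum by (simp add: cscale_Complex sum.distrib)
    from cplx.independentD[OF assms(2,1) subset_refl this z] show ?thesis
      by (simp add: complex_eq_iff)
  qed
  have inj: "inj_on (cscale \<i>) B"
    by (rule inj_onI) (simp add: cscale_def prod_eq_iff)
  \<comment> \<open>A common element z = j w would give the nontrivial relation z - j w = 0; if z =
    w, its coefficient is 1 - j.\<close>
  have disj: "B \<inter> cscale \<i> ` B = {}"
  proof (rule ccontr)
    assume "B \<inter> cscale \<i> ` B \<noteq> {}"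
    then obtain z w where zw: "z \<in> B" "w \<in> B" "z = cscale \<i> w" by blast
    have delta: "(\<Sum>x\<in>B. (if x = y then t else 0) *\<^sub>R h x) = t *\<^sub>R h y"
      if "y \<in> B" for t :: real and y and h :: "_ \<Rightarrow> 'a \<times> 'a"
    proof -
      have "(\<Sum>x\<in>B. (if x = y then t else 0) *\<^sub>R h x) = (\<Sum>x\<in>B. if x = y then t *\<^sub>R h x else 0)"
        by (rule sum.cong) auto
      then show ?thesis using that assms(1) by simp
    qed
    have "(\<Sum>x\<in>B. (if x = z then 1 else 0 :: real) *\<^sub>R x) +
        (\<Sum>x\<in>B. (if x = w then -1 else 0 :: real) *\<^sub>R cscale \<i> x) = 0"
      unfolding delta[OF zw(1), of 1 "\<lambda>x. x"] delta[OF zw(2)] by (simp add: zw(3))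
    from coeffs[OF this zw(1)] show False by simp
  qed
  show "card (B \<union> cscale \<i> ` B) = 2 * card B"
    using assms(1) disj inj by (simp add: card_Un_disjoint card_image)
  show "independent (B \<union> cscale \<i> ` B)"
  proof (rule independent_if_scalars_zero)
    show "f x = 0" if "(\<Sum>x\<in>B \<union> cscale \<i> ` B. f x *\<^sub>R x) = 0" "x \<in> B \<union> cscale \<i> ` B" for f x
    proof -
      have "(\<Sum>z\<in>B. f z *\<^sub>R z) + (\<Sum>z\<in>B. f (cscale \<i> z) *\<^sub>R cscale \<i> z) = 0"
        using that(1) assms(1) disj inj by (simp add: sum.union_disjoint sum.reindex)
      then show ?thesis using coeffs[where b = "\<lambda>z. f (cscale \<i> z)"] that(2) by blast
    qed
  qed (use assms(1) in simp)
qed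

lemma cplx_span_eq_span: "cplx.span B = span (B \<union> cscale \<i> ` B)"
proof (intro equalityI subsetI)
  fix x assume "x \<in> cplx.span B"
  then show "x \<in> span (B \<union> cscale \<i> ` B)"
  proof (induction rule: cplx.span_induct_alt)
    case base
    then show ?case by (rule span_zero)
  next
    case (step c x y)
    have "cscale c x = Re c *\<^sub>R x + Im c *\<^sub>R cscale \<i> x"
      by (metis cscale_Complex complex_surj)
    moreover have "x \<in> span (B \<union> cscale \<i> ` B)" "cscale \<i> x \<in> span (B \<union> cscale \<i> ` B)"
      using step(1) by (auto intro: span_base)
    ultimately show ?case
      using step(2) by (simp add: span_add span_scale)
  qed
next
  have "span (B \<union> cscale \<i> ` B) \<subseteq> cplx.span B"
    using cplx.span_base cplx.span_scale[OF cplx.span_base]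
    by (intro span_minimal cplx_subspace_imp_subspace cplx.subspace_span) blast
  then show "x \<in> span (B \<union> cscale \<i> ` B) \<Longrightarrow> x \<in> cplx.span B" for x by blast
qed

text \<open>Every finite subset doubles to a real independent set, so its size is bounded by the
  real dimension. \<open>dim\<close> counts over the reals, hence the factor 2.\<close>

lemma cplx_independent_card:
  fixes B :: "('v::euclidean_space \<times> 'v) set"
  assumes "cplx.independent B"
  shows "finite B" and "2 * card B = dim (cplx.span B)"
proof -
  have "card G \<le> DIM('v \<times> 'v)" if "G \<subseteq> B" "finite G" for G
  proof -
    have "cplx.independent G" using assms that(1) by (rule cplx.independent_mono)
    from cplx_independent_imp_real[OF that(2) this] show ?thesis
      using independent_bound[of "G \<union> cscale \<i> ` G"] by linarith
  qed
  then show "finite B" using finite_if_finite_subsets_card_bdd by blast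
  note R = cplx_independent_imp_real[OF this assms]
  have "dim (cplx.span B) = card (B \<union> cscale \<i> ` B)"
    unfolding cplx_span_eq_span by (simp add: dim_eq_card_independent[OF R(1)])
  then show "2 * card B = dim (cplx.span B)" using R(2) by simp
qed

text \<open>For an operator \<open>g\<close> with \<open>g\<^sup>3 = - g\<close>, the eigenspace of its complexification for
  the eigenvalue \<open>j\<close>.\<close>

definition holo_space :: "('v \<Rightarrow> 'v) \<Rightarrow> ('v::real_vector \<times> 'v) set" where
  "holo_space g = (\<lambda>x. (x, - g x)) ` range g"

context
  fixes g :: "'v::real_vector \<Rightarrow> 'v"
  assumes linear: "linear g" and cube: "\<And>x. g (g (g x)) = - g x"
begin

text \<open>Since g^2 = -1 on the image of \<open>g\<close>, j (x - j g x) = g x - j g (g x) for x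
  in it: multiplication by j acts through \<open>g\<close>.\<close>

lemma cplx_subspace_holo_space: "cplx.subspace (holo_space g)"
  unfolding cplx.subspace_def
proof (intro conjI ballI allI)
  note lin = linear_0[OF linear] linear_add[OF linear] linear_cmul[OF linear] linear_diff[OF linear]
  have "(g 0, - g (g 0)) \<in> holo_space g" by (auto simp: holo_space_def)
  then show "0 \<in> holo_space g" by (simp add: lin zero_prod_def)
  fix z assume "z \<in> holo_space g"
  then obtain u where z: "z = (g u, - g (g u))" by (auto simp: holo_space_def)
  have "cscale c z = (g (Re c *\<^sub>R u + Im c *\<^sub>R g u), - g (g (Re c *\<^sub>R u + Im c *\<^sub>R g u)))" for c
    by (simp add: z cscale_def lin cube algebra_simps)
  then show "cscale c z \<in> holo_space g" for c by (auto simp: holo_space_def)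
  fix w assume "w \<in> holo_space g"
  then obtain v where w: "w = (g v, - g (g v))" by (auto simp: holo_space_def)
  have "z + w = (g (u + v), - g (g (u + v)))" by (simp add: z w lin)
  then show "z + w \<in> holo_space g" by (auto simp: holo_space_def)
qed

end

text \<open>A graph has the dimension of its base. This is a real count; for g^3 = - g it is twice
  the complex dimension.\<close>

lemma dim_holo_space:
  fixes g :: "'v::euclidean_space \<Rightarrow> 'v"
  assumes "linear g"
  shows "dim (holo_space g) = dim (range g)"
  unfolding holo_space_def
proof (rule dim_image_eq)
  show "linear (\<lambda>x. (x, - g x))"
    by (rule linearI) (simp_all add: linear_add[OF assms] linear_cmul[OF assms])
qed (auto simp: inj_on_def)


section \<open>The eigenbundle of a tensor field with \<open>T\<^sup>3 = - T\<close>\<close>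

text \<open>An f-structure in the sense of Yano, f^3 + f = 0 with constant rank; the data \<alpha>,
  \<beta>, \<open>K\<close> no longer appear.\<close>

locale yano_structure = smooth_mfd M A
  for M :: "'m topology" and A :: "('m, 'e::euclidean_space) chart set" +
  fixes T :: "('m, 'e) tensor11" and r :: nat
  assumes tensor: "tensor_field11 M A T"
    and cube: "\<And>p u. p \<in> topspace M \<Longrightarrow> u \<in> tangent_space A p \<Longrightarrow> T p (T p (T p u)) = - T p u"
    and rank: "\<And>p. p \<in> topspace M \<Longrightarrow> dim (T p ` tangent_space A p) = r"
begin

definition eigenbundle :: "'m \<Rightarrow> ('m, 'e) ctvec set" where
  "eigenbundle p = (\<lambda>x. (x, - T p x)) ` T p ` tangent_space A p"

lemmas T_tangent = tensor_tangent[OF tensor]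
  and T_add = tensor_add[OF tensor]
  and T_scaleR = tensor_scaleR[OF tensor]
  and T_minus = tensor_minus[OF tensor]

lemma T_diff:
  "p \<in> topspace M \<Longrightarrow> u \<in> tangent_space A p \<Longrightarrow> v \<in> tangent_space A p \<Longrightarrow> T p (u - v) = T p u - T p v"
  using T_add[of p u "- v"] T_minus[of p v] subspace_neg[OF subspace_tangent_space] by simp

text \<open>In a chart the operators at different points act on one Euclidean space, so they can be
  composed with each other and compared in norm.\<close>

definition T_chart :: "('m, 'e) chart \<Rightarrow> 'm \<Rightarrow> 'e \<Rightarrow> 'e" where
  "T_chart c q v = T q (coord_vec A c v q) c"

lemma chart_topspace: "c \<in> A \<Longrightarrow> q \<in> fst c \<Longrightarrow> q \<in> topspace M"
  using openin_chart openin_subset by blast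

lemma linear_T_chart: "c \<in> A \<Longrightarrow> q \<in> fst c \<Longrightarrow> linear (T_chart c q)"
  unfolding T_chart_def using tensor by (rule linear_tensor_coords)

lemma T_coord_vec:
  assumes "c \<in> A" "q \<in> fst c"
  shows "T q (coord_vec A c v q) = coord_vec A c (T_chart c q v) q"
  unfolding T_chart_def
  by (intro coord_vec_eq[symmetric] T_tangent coord_vec_tangent chart_topspace[OF assms] assms)

lemma T_chart_cube:
  assumes "c \<in> A" "q \<in> fst c"
  shows "T_chart c q (T_chart c q (T_chart c q v)) = - T_chart c q v"
proof -
  have "T q (T q (T q (coord_vec A c v q))) = - T q (coord_vec A c v q)"
    by (intro cube coord_vec_tangent chart_topspace[OF assms] assms)
  then have "coord_vec A c (T_chart c q (T_chart c q (T_chart c q v))) q c = - coord_vec A c (T_chart c q v) q c"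
    by (simp add: T_coord_vec[OF assms])
  then show ?thesis by (simp add: coord_vec_chart[OF assms])
qed

lemma T_image_chart:
  assumes "c \<in> A" "q \<in> fst c"
  shows "T q ` tangent_space A q = (\<lambda>v. coord_vec A c v q) ` range (T_chart c q)"
proof (intro equalityI subsetI)
  fix x assume "x \<in> T q ` tangent_space A q"
  then obtain u where "u \<in> tangent_space A q" "x = T q u" by blast
  then have "x = coord_vec A c (T_chart c q (u c)) q"
    using coord_vec_eq[OF assms] T_coord_vec[OF assms, of "u c"] by simp
  then show "x \<in> (\<lambda>v. coord_vec A c v q) ` range (T_chart c q)" by blast
next
  fix x assume "x \<in> (\<lambda>v. coord_vec A c v q) ` range (T_chart c q)"
  then obtain v where "x = T q (coord_vec A c v q)" using T_coord_vec[OF assms] by auto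
  then show "x \<in> T q ` tangent_space A q" using coord_vec_tangent[OF assms] by blast
qed

lemma inj_coord_vec: "c \<in> A \<Longrightarrow> q \<in> fst c \<Longrightarrow> inj (\<lambda>v. coord_vec A c v q)"
  by (rule inj_on_inverseI[where g = "\<lambda>u. u c"]) (rule coord_vec_chart)

lemma dim_range_T_chart:
  assumes "c \<in> A" "q \<in> fst c"
  shows "dim (range (T_chart c q)) = r"
proof -
  have "dim ((\<lambda>v. coord_vec A c v q) ` range (T_chart c q)) = dim (range (T_chart c q))"
    using linear_coord_vec[OF assms] inj_on_subset[OF inj_coord_vec[OF assms]]
    by (intro dim_image_eq) auto
  then show ?thesis
    using rank[OF chart_topspace[OF assms]] by (simp add: T_image_chart[OF assms])
qed

lemma eigenbundle_chart:
  assumes "c \<in> A" "q \<in> fst c"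
  shows "eigenbundle q = map_prod (\<lambda>v. coord_vec A c v q) (\<lambda>v. coord_vec A c v q) ` holo_space (T_chart c q)"
  unfolding eigenbundle_def T_image_chart[OF assms] holo_space_def image_image
  by (simp add: T_coord_vec[OF assms] linear_neg[OF linear_coord_vec[OF assms]])

lemma cplx_subspace_eigenbundle:
  assumes "p \<in> topspace M"
  shows "cplx.subspace (eigenbundle p)"
proof -
  obtain c where c: "c \<in> A" "p \<in> fst c" using ex_chart[OF assms] .
  show ?thesis
    unfolding eigenbundle_chart[OF c]
    by (intro module_hom.subspace_image[OF module_hom_map_prod] cplx_subspace_holo_space
        linear_coord_vec linear_T_chart T_chart_cube c)
qed

text \<open>Comparing imaginary parts gives T x = - T x, so T x = 0; as T^2 = -1 on the image of
  \<open>T\<close>, also x = 0.\<close>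

lemma eigenbundle_Int_conj:
  assumes p: "p \<in> topspace M"
  shows "eigenbundle p \<inter> conj_vec ` eigenbundle p = {0}"
proof (intro equalityI subsetI)
  fix z assume "z \<in> eigenbundle p \<inter> conj_vec ` eigenbundle p"
  then obtain x y where xy: "x \<in> T p ` tangent_space A p" "z = (x, - T p x)" "z = (y, T p y)"
    by (auto simp: eigenbundle_def conj_vec_def)
  then obtain u where u: "u \<in> tangent_space A p" "x = T p u" by blast
  have "- T p x = T p x" using xy(2,3) by (metis Pair_inject)
  then have "T p x + T p x = 0" by (simp only: neg_eq_iff_add_eq_0)
  then have "T p x = 0" by (simp flip: scaleR_2)
  then have "T p (T p x) = T p (0 *\<^sub>R u)" by simp
  then have "T p (T p x) = 0" unfolding T_scaleR[OF p u(1)] by simp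
  then have "x = 0" using cube[OF p u(1)] u(2) by simp
  then show "z \<in> {0}" using xy \<open>T p x = 0\<close> by (simp add: zero_prod_def)
next
  fix z :: "('m, 'e) ctvec" assume "z \<in> {0}"
  then have "z \<in> eigenbundle p" "z = conj_vec z"
    using cplx.subspace_0[OF cplx_subspace_eigenbundle[OF p]] by (auto simp: conj_vec_def zero_prod_def)
  then show "z \<in> eigenbundle p \<inter> conj_vec ` eigenbundle p" by blast
qed

text \<open>The operator \<open>\<beta> = (g\<^sub>q\<^sup>2 g\<^sub>p\<^sup>2 - g\<^sub>q g\<^sub>p) / 2\<close> satisfies \<open>g\<^sub>q \<beta> = \<beta> g\<^sub>p\<close>, so it maps the eigenspace at \<open>p\<close>
  to the one at \<open>q\<close>; as it is the identity on the image of \<open>g\<^sub>p\<close> when \<open>q = p\<close>, it stays injective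
  there for \<open>q\<close> close to \<open>p\<close>.\<close>

lemma eigenbundle_local_frame:
  assumes p: "p \<in> topspace M"
  obtains U Z where "openin M U" "p \<in> U"
    and "\<And>i. i < r div 2 \<Longrightarrow> cvector_field A U (Z i)"
    and "\<And>q. q \<in> U \<Longrightarrow> inj_on (\<lambda>i. Z i q) {..<r div 2}"
    and "\<And>q. q \<in> U \<Longrightarrow> cplx.independent ((\<lambda>i. Z i q) ` {..<r div 2})"
    and "\<And>q. q \<in> U \<Longrightarrow> cplx.span ((\<lambda>i. Z i q) ` {..<r div 2}) = eigenbundle q"
proof -
  obtain c where c: "c \<in> A" "p \<in> fst c" using ex_chart[OF p] .
  let ?g = "T_chart c" and ?\<iota> = "\<lambda>q v. coord_vec A c v q"
  let ?gp = "?g p"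
  note lin = linear_T_chart[OF c(1)] and g3 = T_chart_cube[OF c(1)]
  note lin_simps = linear_add[OF lin] linear_diff[OF lin] linear_cmul[OF lin] linear_neg[OF lin]
  have h_sub: "cplx.subspace (holo_space (?g q))" if "q \<in> fst c" for q
    using lin[OF that] g3[OF that] by (rule cplx_subspace_holo_space)
  have h_dim: "dim (holo_space (?g q)) = r" if "q \<in> fst c" for q
    using dim_holo_space[OF lin[OF that]] dim_range_T_chart[OF c(1) that] by simp

  obtain B where B: "B \<subseteq> holo_space ?gp" "cplx.independent B" "holo_space ?gp \<subseteq> cplx.span B"
    by (rule cplx.basis_exists)
  have span_B: "cplx.span B = holo_space ?gp"
    using B h_sub[OF c(2)] by (intro equalityI cplx.span_minimal)
  have card_B: "finite B" "2 * card B = r"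
    using cplx_independent_card[OF B(2)] span_B h_dim[OF c(2)] by auto
  \<comment> \<open>Because \<open>2 * card B = r\<close>, the number \<open>r div 2\<close> is the
    exact complex rank.\<close>
  obtain z where z: "bij_betw z {..<r div 2} B"
    using ex_bij_betw_nat_finite[OF card_B(1)] card_B(2) by (metis atLeast0LessThan nonzero_mult_div_cancel_left zero_neq_numeral)

  \<comment> \<open>With P = - g^2, the projection onto the image, \<beta> is half the sum of P_q
    P_p and - g_q P_q P_p g_p = - g_q g_p. Averaging over the complex structures on the two images
    makes it intertwine them.\<close>
  define \<beta> where "\<beta> q v = (1/2) *\<^sub>R (?g q (?g q (?gp (?gp v))) - ?g q (?gp v))" for q v
  \<comment> \<open>The vector field with chart components \<open>\<beta> q v\<close>, written with
    \<open>T\<close> and coordinate fields of constant vectors so that its smoothness is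
    immediate.\<close>
  define E where "E v q = (1/2) *\<^sub>R (T q (T q (?\<iota> q (?gp (?gp v)))) + - T q (?\<iota> q (?gp v)))" for v q
  have E: "E v q = ?\<iota> q (\<beta> q v)" if "q \<in> fst c" for v q
    unfolding E_def \<beta>_def T_coord_vec[OF c(1) that]
    by (simp add: linear_diff[OF linear_coord_vec[OF c(1) that]] linear_cmul[OF linear_coord_vec[OF c(1) that]])
  have E_field: "vector_field A (fst c) (E v)" for v
    unfolding E_def
    by (intro vector_field_scaleR vector_field_add vector_field_minus vector_field_tensor[OF tensor]
        vector_field_coord_vec openin_chart c(1))
  have lin_\<beta>: "linear (\<beta> q)" if "q \<in> fst c" for q
    unfolding \<beta>_def by (rule linearI) (simp_all add: lin_simps that c(2) algebra_simps)
  have comm: "?g q (\<beta> q v) = \<beta> q (?gp v)" if "q \<in> fst c" for q v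
    unfolding \<beta>_def by (simp add: lin_simps g3 that c(2))
  have \<beta>_p: "\<beta> p (?gp v) = ?gp v" for v
    unfolding \<beta>_def by (simp add: lin_simps g3 c(2) flip: scaleR_2)

  \<comment> \<open>Sum of the norms of the columns of \<open>\<beta> q\<close> minus
    \<open>\<beta> p\<close>, in the coordinate x of q: a continuous upper bound for the operator
    norm that is 0 at \<open>p\<close>.\<close>
  let ?f = "\<lambda>x. \<Sum>b\<in>Basis. norm (local_rep (E b) c x - \<beta> p b)"
  let ?S = "{x \<in> snd c ` fst c. ?f x < 1}"
  define U where "U = {q \<in> fst c. snd c q \<in> ?S}"
  have "continuous_on (snd c ` fst c) ?f"
    using smooth_on_imp_continuous_on[OF vector_field_smooth[OF E_field c(1)]]
    by (intro continuous_intros) simp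
  then have "open (?f -` {..<1} \<inter> snd c ` fst c)"
    using continuous_on_open_vimage[OF open_chart_range[OF c(1)]] open_lessThan by blast
  then have "open ?S" by (rule back_subst[where P = "open"]) auto
  then have U: "openin M U"
    unfolding U_def by (rule openin_chart_preimage[OF c(1)])
  have rep: "local_rep (E v) c (snd c q) = \<beta> q v" if "q \<in> fst c" for v q
    using that c(1) by (simp add: local_rep_chart E coord_vec_chart)
  have pU: "p \<in> U" using c(2) by (simp add: U_def rep)
  have Uc: "U \<subseteq> fst c" by (auto simp: U_def)
  have small: "(\<Sum>b\<in>Basis. norm (\<beta> q b - \<beta> p b)) < 1" if "q \<in> U" for q
  proof -
    have "q \<in> fst c" "?f (snd c q) < 1" using that unfolding U_def by blast+
    then show ?thesis by (simp add: rep)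
  qed

  \<comment> \<open>\<open>\<beta> p\<close> fixes \<open>x\<close>, so a kernel element equals its
    own image under \<open>\<beta> p\<close> minus \<open>\<beta> q\<close>, an operator of norm
    below 1.\<close>
  have \<beta>_ker: "x = 0" if q: "q \<in> U" and x: "x \<in> range ?gp" and "\<beta> q x = 0" for q x
  proof (rule ccontr)
    assume "x \<noteq> 0"
    have qc: "q \<in> fst c" using q Uc by blast
    have l: "linear (\<lambda>x. \<beta> q x - \<beta> p x)"
      using lin_\<beta>[OF qc] lin_\<beta>[OF c(2)] by (rule linear_compose_sub)
    have "norm x = norm (\<beta> q x - \<beta> p x)"
      using x \<beta>_p that(3) by auto
    also have "\<dots> = norm (\<Sum>b\<in>Basis. (x \<bullet> b) *\<^sub>R (\<beta> q b - \<beta> p b))"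
      using linear_eq_sum_Basis[OF l, of x] by simp
    also have "\<dots> \<le> (\<Sum>b\<in>Basis. norm x * norm (\<beta> q b - \<beta> p b))"
      by (rule order_trans[OF norm_sum sum_mono]) (simp add: Basis_le_norm mult_right_mono)
    also have "\<dots> = norm x * (\<Sum>b\<in>Basis. norm (\<beta> q b - \<beta> p b))"
      by (simp add: sum_distrib_left)
    also have "\<dots> < norm x * 1"
      using small[OF q] \<open>x \<noteq> 0\<close> by (intro mult_strict_left_mono) auto
    finally show False by simp
  qed

  let ?\<Phi> = "\<lambda>q. map_prod (\<lambda>v. ?\<iota> q (\<beta> q v)) (\<lambda>v. ?\<iota> q (\<beta> q v))"
  have hom: "module_hom cscale cscale (?\<Phi> q)" if "q \<in> fst c" for q
    by (rule module_hom_map_prod)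
      (rule linear_compose[OF lin_\<beta>[OF that] linear_coord_vec[OF c(1) that], unfolded o_def])
  have \<beta>_inj: "inj_on (\<beta> q) (range ?gp)" if q: "q \<in> U" for q
  proof (rule inj_onI)
    have qc: "q \<in> fst c" using q Uc by blast
    fix x y assume xy: "x \<in> range ?gp" "y \<in> range ?gp" "\<beta> q x = \<beta> q y"
    then have "x - y \<in> range ?gp"
      by (auto simp flip: linear_diff[OF lin[OF c(2)]])
    then show "x = y"
      using \<beta>_ker[OF q, of "x - y"] xy(3) linear_diff[OF lin_\<beta>[OF qc]] by simp
  qed
  have \<Phi>_inj: "inj_on (?\<Phi> q) (holo_space ?gp)" if q: "q \<in> U" for q
  proof (rule inj_onI)
    have qc: "q \<in> fst c" using q Uc by blast
    fix z w assume zw: "z \<in> holo_space ?gp" "w \<in> holo_space ?gp" "?\<Phi> q z = ?\<Phi> q w"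
    then obtain x y where xy: "z = (x, - ?gp x)" "w = (y, - ?gp y)" "x \<in> range ?gp" "y \<in> range ?gp"
      by (auto simp: holo_space_def)
    then have "\<beta> q x = \<beta> q y"
      using zw(3) inj_coord_vec[OF c(1) qc] by (auto dest: injD)
    then have "x = y" using \<beta>_inj[OF q] xy(3,4) by (auto dest: inj_onD)
    then show "z = w" using xy by simp
  qed
  have \<Phi>_image: "?\<Phi> q ` holo_space ?gp = eigenbundle q" if q: "q \<in> U" for q
  proof -
    have qc: "q \<in> fst c" using q Uc by blast
    note lb = lin_\<beta>[OF qc]
    let ?bb = "map_prod (\<beta> q) (\<beta> q)"
    have sub: "?bb ` holo_space ?gp \<subseteq> holo_space (?g q)"
    proof -
      have "?bb (?gp u, - ?gp (?gp u)) = (?g q (\<beta> q u), - ?g q (?g q (\<beta> q u)))" for u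
        using comm[OF qc] by (simp add: linear_neg[OF lb])
      then show ?thesis by (auto simp: holo_space_def)
    qed
    have linb2: "linear ?bb"
      by (rule linearI) (auto simp: linear_add[OF lb] linear_cmul[OF lb])
    have \<Phi>_comp: "?\<Phi> q = map_prod (?\<iota> q) (?\<iota> q) \<circ> ?bb"
      by (rule ext) auto
    then have inj: "inj_on ?bb (holo_space ?gp)"
      using \<Phi>_inj[OF q] by (metis inj_on_imageI2)
    \<comment> \<open>The inclusion comes from the intertwining relation; equality follows from
      injectivity and equal real dimensions, which is where constant rank enters.\<close>
    have "?bb ` holo_space ?gp = holo_space (?g q)"
    proof (rule subspace_dim_equal[OF _ _ sub])
      have sub0: "subspace (holo_space ?gp)"
        using h_sub[OF c(2)] by (rule cplx_subspace_imp_subspace)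
      then show "subspace (?bb ` holo_space ?gp)" by (rule linear_subspace_image[OF linb2])
      show "subspace (holo_space (?g q))" using h_sub[OF qc] by (rule cplx_subspace_imp_subspace)
      have "inj_on ?bb (span (holo_space ?gp))"
        using inj sub0 by (simp add: span_eq_iff[THEN iffD2])
      from dim_image_eq[OF linb2 this]
      show "dim (?bb ` holo_space ?gp) \<ge> dim (holo_space (?g q))"
        using h_dim[OF qc] h_dim[OF c(2)] by simp
    qed
    then show ?thesis
      unfolding eigenbundle_chart[OF c(1) qc] \<Phi>_comp image_comp[symmetric] by simp
  qed

  define Z where "Z i q = (E (fst (z i)) q, E (snd (z i)) q)" for i q
  have Z: "Z i q = ?\<Phi> q (z i)" if "q \<in> fst c" for i q
    by (simp add: Z_def E that map_prod_def split_beta)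
  have Z_image: "(\<lambda>i. Z i q) ` {..<r div 2} = ?\<Phi> q ` B" if "q \<in> fst c" for q
    using z by (auto simp: Z[OF that] bij_betw_def image_image[of "?\<Phi> q" z, symmetric] simp del: map_prod_simp)
  show thesis
  proof (rule that[OF U pU])
    show "cvector_field A U (Z i)" for i
      using vector_field_subset[OF E_field Uc] by (simp add: cvector_field_def Z_def o_def)
    fix q assume q: "q \<in> U"
    then have qc: "q \<in> fst c" using Uc by blast
    show "inj_on (\<lambda>i. Z i q) {..<r div 2}"
      unfolding Z[OF qc] using z B(1) \<Phi>_inj[OF q]
      by (auto simp: bij_betw_def intro!: comp_inj_on[of z _ "?\<Phi> q", unfolded o_def] intro: inj_on_subset)
    show "cplx.independent ((\<lambda>i. Z i q) ` {..<r div 2})"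
      unfolding Z_image[OF qc]
      by (rule module_hom.independent_injective_image[OF hom[OF qc] B(2)])
        (use \<Phi>_inj[OF q] span_B in simp)
    show "cplx.span ((\<lambda>i. Z i q) ` {..<r div 2}) = eigenbundle q"
      unfolding Z_image[OF qc] module_hom.span_image[OF hom[OF qc]]
      using \<Phi>_image[OF q] span_B by simp
  qed
qed

lemma complex_subbundle_eigenbundle: "complex_subbundle M A eigenbundle"
  unfolding complex_subbundle_def
proof (intro conjI ballI exI[of _ "r div 2"])
  fix p assume p: "p \<in> topspace M"
  show "cplx.subspace (eigenbundle p)" using p by (rule cplx_subspace_eigenbundle)
  show "eigenbundle p \<subseteq> ctangent_space A p"
    using p T_tangent subspace_neg[OF subspace_tangent_space]
    by (auto simp: eigenbundle_def ctangent_space_def)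
  obtain U Z where "openin M U" "p \<in> U" "\<And>i. i < r div 2 \<Longrightarrow> cvector_field A U (Z i)"
    "\<And>q. q \<in> U \<Longrightarrow> inj_on (\<lambda>i. Z i q) {..<r div 2}"
    "\<And>q. q \<in> U \<Longrightarrow> cplx.independent ((\<lambda>i. Z i q) ` {..<r div 2})"
    "\<And>q. q \<in> U \<Longrightarrow> cplx.span ((\<lambda>i. Z i q) ` {..<r div 2}) = eigenbundle q"
    using eigenbundle_local_frame[OF p] by metis
  then show "\<exists>U Z. openin M U \<and> p \<in> U \<and> (\<forall>i<r div 2. cvector_field A U (Z i)) \<and>
      (\<forall>q\<in>U. inj_on (\<lambda>i. Z i q) {..<r div 2} \<and>
        cplx.independent ((\<lambda>i. Z i q) ` {..<r div 2}) \<and>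
        cplx.span ((\<lambda>i. Z i q) ` {..<r div 2}) = eigenbundle q)"
    by blast
qed

text \<open>Put a = [X,Y], e = [TX,TY], s = [TX,Y], t = [X,TY]. As T^2 = -1 on sections, the
  Nijenhuis tensor on (X,Y), (X,TY), (TX,Y), (TX,TY) gives four linear relations between a, e, s, t
  and their images under T. The bracket in question is (a - e) - j (s + t).\<close>

lemma involutive_eigenbundle:
  assumes N: "integrable_tensor M A T"
  shows "involutive M A eigenbundle"
  unfolding involutive_def
proof (intro allI impI ballI; elim conjE)
  fix U Z W p
  assume U: "openin M U" and Z: "cvector_field A U Z" and W: "cvector_field A U W"
    and H: "\<forall>p\<in>U. Z p \<in> eigenbundle p \<and> W p \<in> eigenbundle p" and p: "p \<in> U"
  have UM: "q \<in> topspace M" if "q \<in> U" for q using U openin_subset that by blast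
  define X where "X = fst \<circ> Z"
  define Y where "Y = fst \<circ> W"
  define TX where "TX = (\<lambda>q. T q (X q))"
  define TY where "TY = (\<lambda>q. T q (Y q))"
  define TTX where "TTX = (\<lambda>q. T q (TX q))"
  define TTY where "TTY = (\<lambda>q. T q (TY q))"
  have X: "vector_field A U X" and Y: "vector_field A U Y"
    and Z2: "vector_field A U (snd \<circ> Z)" and W2: "vector_field A U (snd \<circ> W)"
    using Z W by (auto simp: cvector_field_def X_def Y_def)
  have TX: "vector_field A U TX" and TY: "vector_field A U TY"
    unfolding TX_def TY_def using X Y by (auto intro: vector_field_tensor[OF tensor U])
  have TTX: "vector_field A U TTX" and TTY: "vector_field A U TTY"
    unfolding TTX_def TTY_def using TX TY by (auto intro: vector_field_tensor[OF tensor U])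
  have TT: "T q (T q x) = - x" if "q \<in> U" "x \<in> T q ` tangent_space A q" for q x
    using that cube[OF UM] by auto
  have Z': "X q \<in> T q ` tangent_space A q" "(snd \<circ> Z) q = - TX q"
    and W': "Y q \<in> T q ` tangent_space A q" "(snd \<circ> W) q = - TY q" if "q \<in> U" for q
    using H that by (fastforce simp: eigenbundle_def X_def Y_def TX_def TY_def)+
  have TTX_eq: "TTX q = - X q" and TTY_eq: "TTY q = - Y q" if "q \<in> U" for q
    using TT[OF that] Z'(1)[OF that] W'(1)[OF that] by (simp_all add: TTX_def TTY_def TX_def TY_def)
  let ?b = "\<lambda>V W. lie_bracket A V W p"
  note cong = lie_bracket_cong[OF U _ _ p]
  have minus: "?b V' W = - ?b V W" "?b W V' = - ?b W V"
    if "vector_field A U V'" "\<And>q. q \<in> U \<Longrightarrow> V' q = - V q" "vector_field A U V" "vector_field A U W"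
    for V V' W
    using cong[of V' W "\<lambda>q. - V q" W] cong[of W V' W "\<lambda>q. - V q"] that
      lie_bracket_minus_left[OF that(3,4) p] lie_bracket_minus_right[OF that(4,3) p] by simp_all
  define a where "a = ?b X Y"
  define e where "e = ?b TX TY"
  define s where "s = ?b TX Y"
  define t where "t = ?b X TY"
  have tan: "a \<in> tangent_space A p" "e \<in> tangent_space A p" "s \<in> tangent_space A p" "t \<in> tangent_space A p"
    unfolding a_def e_def s_def t_def using X Y TX TY p by (auto intro: lie_bracket_tangent[OF U])
  note pM = UM[OF p]
  note tanT = T_tangent[OF pM] subspace_add[OF subspace_tangent_space]
    subspace_diff[OF subspace_tangent_space] subspace_neg[OF subspace_tangent_space] tan
  note T_lin = T_add[OF pM] T_diff[OF pM] T_minus[OF pM]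
  have n: "?b TV TW - T p (?b TV W) - T p (?b V TW) + T p (T p (?b V W)) = 0"
    if "vector_field A U V" "vector_field A U W" "TV = (\<lambda>q. T q (V q))" "TW = (\<lambda>q. T q (W q))"
    for V W TV TW
    using nijenhuis_eq_0[OF tensor N U that(1,2) p] by (simp add: nijenhuis_def that(3,4))
  have n1: "e - T p s - T p t + T p (T p a) = 0"
    using n[OF X Y TX_def TY_def] by (simp add: a_def e_def s_def t_def)
  have n2: "- s - T p e - T p (- a) + T p (T p t) = 0"
    using n[OF X TY TX_def TTY_def] minus[OF TTY TTY_eq Y TX] minus[OF TTY TTY_eq Y X]
    by (simp add: a_def e_def s_def t_def)
  have n3: "- t - T p (- a) - T p e + T p (T p s) = 0"
    using n[OF TX Y TTX_def TY_def] minus[OF TTX TTX_eq X TY] minus[OF TTX TTX_eq X Y]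
    by (simp add: a_def e_def s_def t_def)
  have n4: "a - T p (- t) - T p (- s) + T p (T p e) = 0"
    using n[OF TX TY TTX_def TTY_def] minus(1)[OF TTX TTX_eq X TTY] minus(2)[OF TTY TTY_eq Y X]
      minus(1)[OF TTX TTX_eq X TY] minus(2)[OF TTY TTY_eq Y TX]
    by (simp add: a_def e_def s_def t_def)
  \<comment> \<open>\<open>n4\<close> exhibits a, and \<open>n1\<close> exhibits e, as a value of T;
    hence their difference lies in the image.\<close>
  have a: "a = T p (- t - s - T p e)"
    by (subst eq_iff_diff_eq_0, rule trans[OF _ n4]) (simp add: T_lin tanT algebra_simps)
  have e: "e = T p (s + t - T p a)"
    by (subst eq_iff_diff_eq_0, rule trans[OF _ n1]) (simp add: T_lin tanT algebra_simps)
  have "a - e = T p (- t - s - T p e) - T p (s + t - T p a)"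
    using arg_cong2[where f = minus, OF a e] .
  also have "\<dots> = T p ((- t - s - T p e) - (s + t - T p a))"
    by (rule T_diff[OF pM, symmetric]) (intro tanT)+
  finally have "a - e = T p ((- t - s - T p e) - (s + t - T p a))" .
  then have range: "a - e \<in> T p ` tangent_space A p"
    by (rule image_eqI[where f = "T p"]) (intro tanT)
  \<comment> \<open>\<open>n3\<close> puts t in the image of T, so T (T t) = - t, and
    \<open>n2\<close> turns into T (a - e) = s + t.\<close>
  have "T p (a - e + T p s) - t = 0"
    by (rule trans[OF _ n3]) (simp add: T_lin tanT algebra_simps)
  then have "t = T p (a - e + T p s)" by simp
  then have "t \<in> T p ` tangent_space A p"
    by (rule image_eqI[where f = "T p"]) (intro tanT)
  from TT[OF p this] have "T p (a - e) - (s + t) = 0"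
    by (intro trans[OF _ n2]) (simp add: T_lin tanT algebra_simps)
  then have "T p (a - e) = s + t" by simp
  moreover have "clie_bracket A Z W p = (a - e, - t - s)"
  proof -
    have "?b (snd \<circ> Z) (snd \<circ> W) = e"
      using minus(1)[OF Z2 Z'(2) TX W2] minus(2)[OF W2 W'(2) TY TX] by (simp add: e_def o_def)
    moreover have "?b X (snd \<circ> W) = - t" using minus(2)[OF W2 W'(2) TY X] by (simp add: t_def o_def)
    moreover have "?b (snd \<circ> Z) Y = - s" using minus(1)[OF Z2 Z'(2) TX Y] by (simp add: s_def o_def)
    ultimately show ?thesis
      by (simp add: clie_bracket_def flip: X_def Y_def) (simp add: a_def)
  qed
  ultimately show "clie_bracket A Z W p \<in> eigenbundle p"
    using range by (auto simp: eigenbundle_def)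
qed

theorem CR_structure_eigenbundle:
  assumes "integrable_tensor M A T"
  shows "CR_structure M A eigenbundle"
  unfolding CR_structure_def
  using complex_subbundle_eigenbundle eigenbundle_Int_conj involutive_eigenbundle[OF assms] by blast

end


section \<open>F-structures of degree \<open>K\<close>\<close>

lemma complexify_pow_real:
  assumes "F p 0 = 0"
  shows "(complexify F p ^^ n) (u, 0) = ((F p ^^ n) u, 0)"
  by (induction n) (simp_all only: funpow.simps id_apply o_apply complexify_def map_prod_simp assms)

text \<open>Since \<open>F l = F\<close> and \<open>l\<close> is \<open>F\<close> times a polynomial in \<open>F\<close> (as \<open>K \<ge> 2\<close>), the operators
  \<open>F\<close>, \<open>l\<close> and \<open>Fhat\<close> have the same image. Only the real parts of \<open>\<alpha>\<close>, \<open>\<beta>\<close> matter on real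
  vectors, because \<open>l = - Fhat\<^sup>2\<close> is real.\<close>

lemma (in smooth_mfd) F_hat_properties:
  assumes K: "K \<ge> 3" and F: "F_structure M A \<alpha> \<beta> K r F" and G: "is_F_hat M A \<alpha> \<beta> K F G"
    and p: "p \<in> topspace M"
  shows "u \<in> tangent_space A p \<Longrightarrow> G p (G p (G p u)) = - G p u"
    and "G p ` tangent_space A p = F p ` tangent_space A p"
    and "D_l A \<alpha> \<beta> K F p = G p ` tangent_space A p"
proof -
  let ?T = "tangent_space A p"
  note T0 = subspace_0[OF subspace_tangent_space, of p]
  have tF: "tensor_field11 M A F" and tG: "tensor_field11 M A G"
    using F G by (auto simp: F_structure_def is_F_hat_def)
  note F0 = tensor_zero[OF tF p] and G0 = tensor_zero[OF tG p]
  note FT = tensor_tangent[OF tF p] and GT = tensor_tangent[OF tG p]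
  have real: "(u, 0) \<in> ctangent_space A p" if "u \<in> ?T" for u
    using that T0 by (simp add: ctangent_space_def)
  have sq: "complexify G p (complexify G p z) =
      cscale \<alpha> ((complexify F p ^^ K) z) + cscale \<beta> ((complexify F p ^^ (K - 1)) z)"
    and lG: "proj_l \<alpha> \<beta> K F p (complexify G p z) = complexify G p z"
    if "z \<in> ctangent_space A p" for z
    using G p that unfolding is_F_hat_def by blast+
  have l: "proj_l \<alpha> \<beta> K F p (u, 0) = (- G p (G p u), 0)" if "u \<in> ?T" for u
  proof -
    have "proj_l \<alpha> \<beta> K F p (u, 0) = - complexify G p (complexify G p (u, 0))"
      unfolding proj_l_def sq[OF real[OF that]] ..
    then show ?thesis by (simp only: complexify_def map_prod_simp G0 uminus_Pair minus_zero)
  qed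
  \<comment> \<open>This is l G = G with l = - G^2.\<close>
  show G3: "G p (G p (G p u)) = - G p u" if "u \<in> ?T" for u
    using lG[OF real[OF that]] l[OF GT[OF that]] by (simp add: complexify_def G0 minus_equation_iff[of "G p (G p (G p u))"])
  have GG: "G p (G p u) = Re \<alpha> *\<^sub>R (F p ^^ K) u + Re \<beta> *\<^sub>R (F p ^^ (K - 1)) u" if "u \<in> ?T" for u
    using arg_cong[OF sq[OF real[OF that]], of fst]
    by (simp add: complexify_pow_real[of F p, OF F0]) (simp add: complexify_def cscale_def)
  have Feq: "Re \<alpha> *\<^sub>R (F p ^^ (K + 1)) u + Re \<beta> *\<^sub>R (F p ^^ K) u + F p u = 0" if "u \<in> ?T" for u
  proof -
    have "cscale \<alpha> ((complexify F p ^^ (K + 1)) (u, 0)) + cscale \<beta> ((complexify F p ^^ K) (u, 0))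
        + complexify F p (u, 0) = 0"
      using F p real[OF that] unfolding F_structure_def by blast
    from arg_cong[OF this, of fst] show ?thesis
      unfolding complexify_pow_real[of F p, OF F0] by (simp add: complexify_def cscale_def)
  qed
  have pow: "(F p ^^ n) u \<in> ?T" if "u \<in> ?T" for n u
    using that by (induction n) (simp_all add: FT)
  \<comment> \<open>The structure equation says (\<alpha> F^K + \<beta> F^(K-1)) F = - F, and the
    factor in parentheses is G^2.\<close>
  have GGF: "G p (G p (F p u)) = - F p u" if "u \<in> ?T" for u
  proof -
    have "(F p ^^ (K - 1)) (F p u) = (F p ^^ K) u"
      using K funpow_swap1[of "F p" "K - 1" u] by (cases K) simp_all
    then show ?thesis
      using GG[OF FT[OF that]] Feq[OF that] by (simp add: funpow_swap1 add_eq_0_iff2)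
  qed
  show "G p ` ?T = F p ` ?T"
  proof (intro equalityI image_subsetI)
    fix u assume u: "u \<in> ?T"
    have "F p u = G p (G p (- F p u))"
      using GGF[OF u] FT[OF u] GT tensor_minus[OF tG p] by simp
    then show "F p u \<in> G p ` ?T"
      by (rule image_eqI[where f = "G p"]) (intro GT FT u subspace_neg[OF subspace_tangent_space])
    let ?v = "- G p u"
    have v: "?v \<in> ?T" using GT[OF u] by (rule subspace_neg[OF subspace_tangent_space])
    \<comment> \<open>Preimage found by taking one factor \<open>F\<close> out of G^2; writing
      \<open>K\<close> as \<open>Suc (Suc k)\<close> removes the truncated subtraction.\<close>
    let ?w = "Re \<alpha> *\<^sub>R (F p ^^ (K - 1)) ?v + Re \<beta> *\<^sub>R (F p ^^ (K - 2)) ?v"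
    obtain k where k: "K = Suc (Suc k)" using that[of "K - 2"] K by simp
    have "G p u = G p (G p ?v)"
      using G3[OF u] GT[OF u] GT[OF GT[OF u]] tensor_minus[OF tG p] by simp
    also have "\<dots> = F p ?w"
      unfolding GG[OF v]
      using pow[OF v] by (simp add: k tensor_add[OF tF p] tensor_scaleR[OF tF p] FT
          subspace_scale[OF subspace_tangent_space])
    finally show "G p u \<in> F p ` ?T"
      by (rule image_eqI[where f = "F p"])
        (intro subspace_add[OF subspace_tangent_space] subspace_scale[OF subspace_tangent_space] pow v)
  qed
  show "D_l A \<alpha> \<beta> K F p = G p ` ?T"
  proof (intro equalityI subsetI)
    fix x assume "x \<in> D_l A \<alpha> \<beta> K F p"
    then obtain y where y: "y \<in> ?T" "x = - G p (G p y)"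
      unfolding D_l_def of_tvec_def using l by auto
    then have "x = G p (- G p y)"
      using tensor_minus[OF tG p GT[OF y(1)]] by simp
    then show "x \<in> G p ` ?T"
      by (rule image_eqI[where f = "G p"]) (intro GT y subspace_neg[OF subspace_tangent_space])
  next
    fix x assume "x \<in> G p ` ?T"
    then obtain u where u: "u \<in> ?T" "x = G p u" by blast
    then have "(x, 0) = proj_l \<alpha> \<beta> K F p (x, 0)"
      using l[OF GT[OF u(1)]] G3[OF u(1)] by simp
    then show "x \<in> D_l A \<alpha> \<beta> K F p"
      unfolding D_l_def of_tvec_def using u GT by blast
  qed
qed

text \<open>Bundles are functions on the whole type, and the two descriptions of \<open>H\<close>
  are only known to agree on \<open>topspace M\<close>; sections live on open sets, which lie inside
  it.\<close>

lemma CR_structure_cong: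
  assumes "\<And>p. p \<in> topspace M \<Longrightarrow> H p = H' p" and "CR_structure M A H"
  shows "CR_structure M A H'"
proof -
  have U: "H q = H' q" if "openin M U" "q \<in> U" for U q
    using that assms(1) openin_subset by blast
  have "complex_subbundle M A H'"
    unfolding complex_subbundle_def
  proof (intro conjI ballI)
    show "cplx.subspace (H' p)" "H' p \<subseteq> ctangent_space A p" if "p \<in> topspace M" for p
      using assms(2) that unfolding CR_structure_def complex_subbundle_def assms(1)[OF that, symmetric]
      by blast+
    obtain d :: nat where d: "\<forall>p\<in>topspace M. \<exists>U Z. openin M U \<and> p \<in> U \<and> (\<forall>i<d. cvector_field A U (Z i)) \<and>
        (\<forall>q\<in>U. inj_on (\<lambda>i. Z i q) {..<d} \<and> cplx.independent ((\<lambda>i. Z i q) ` {..<d}) \<and>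
          cplx.span ((\<lambda>i. Z i q) ` {..<d}) = H q)"
      using assms(2) unfolding CR_structure_def complex_subbundle_def by blast
    show "\<exists>d::nat. \<forall>p\<in>topspace M. \<exists>U Z. openin M U \<and> p \<in> U \<and> (\<forall>i<d. cvector_field A U (Z i)) \<and>
        (\<forall>q\<in>U. inj_on (\<lambda>i. Z i q) {..<d} \<and> cplx.independent ((\<lambda>i. Z i q) ` {..<d}) \<and>
          cplx.span ((\<lambda>i. Z i q) ` {..<d}) = H' q)"
    proof (intro exI[of _ d] ballI)
      fix p assume "p \<in> topspace M"
      from bspec[OF d this] obtain U Z where UZ: "openin M U" "p \<in> U" "\<forall>i<d. cvector_field A U (Z i)"
        "\<forall>q\<in>U. inj_on (\<lambda>i. Z i q) {..<d} \<and> cplx.independent ((\<lambda>i. Z i q) ` {..<d}) \<and>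
          cplx.span ((\<lambda>i. Z i q) ` {..<d}) = H q"
        by (elim exE conjE) (rule that)
      then show "\<exists>U Z. openin M U \<and> p \<in> U \<and> (\<forall>i<d. cvector_field A U (Z i)) \<and>
        (\<forall>q\<in>U. inj_on (\<lambda>i. Z i q) {..<d} \<and> cplx.independent ((\<lambda>i. Z i q) ` {..<d}) \<and>
          cplx.span ((\<lambda>i. Z i q) ` {..<d}) = H' q)"
        using U[OF UZ(1)] by (intro exI[of _ U] exI[of _ Z]) auto
    qed
  qed
  moreover have "involutive M A H'"
    unfolding involutive_def
  proof (intro allI impI ballI)
    fix V Z W p
    assume *: "openin M V \<and> cvector_field A V Z \<and> cvector_field A V W \<and> (\<forall>p\<in>V. Z p \<in> H' p \<and> W p \<in> H' p)"
      and p: "p \<in> V"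
    then have "\<forall>p\<in>V. Z p \<in> H p \<and> W p \<in> H p" using U by blast
    then have "clie_bracket A Z W p \<in> H p"
      using assms(2) * p unfolding CR_structure_def involutive_def by blast
    then show "clie_bracket A Z W p \<in> H' p" using U * p by blast
  qed
  ultimately show ?thesis
    using assms unfolding CR_structure_def by simp
qed

theorem theorem4p3:
  fixes M :: "'m topology"
    and A :: "('m, 'e::euclidean_space) chart set"
    and F Fhat :: "('m, 'e) tensor11"
    and \<alpha> \<beta> :: complex
    and K k :: nat
  assumes "smooth_manifold M A"
    and "K \<ge> 3"
    and "F_structure M A \<alpha> \<beta> K (2 * k) F"
    and "is_F_hat M A \<alpha> \<beta> K F Fhat"
    and "integrable_tensor M A Fhat"
  shows "CR_structure M A (H_bundle A \<alpha> \<beta> K F Fhat)"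
proof -
  interpret smooth_mfd M A using assms(1) by unfold_locales
  note props = F_hat_properties[OF assms(2-4)]
  interpret yano_structure M A Fhat "2 * k"
  proof
    show "tensor_field11 M A Fhat" using assms(4) by (simp add: is_F_hat_def)
    show "dim (Fhat p ` tangent_space A p) = 2 * k" if "p \<in> topspace M" for p
      using props(2)[OF that] assms(3) that by (simp add: F_structure_def)
  qed (rule props(1))
  have "H_bundle A \<alpha> \<beta> K F Fhat p = eigenbundle p" if "p \<in> topspace M" for p
    by (auto simp: H_bundle_def eigenbundle_def props(3)[OF that] of_tvec_def cscale_def)
  then show ?thesis
    using CR_structure_cong[OF _ CR_structure_eigenbundle[OF assms(5)]] by metis
qed

end
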